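(* Let $\mathbb{B}$ be a bicategory and $\eta_f,\varepsilon_f:f\dashv f^*:\mathcal{B}\to\mathcal{A}$ an adjunction in $\mathbb{B}$ (so $f:\mathcal{A}\to\mathcal{B}$). (i) If $f$ is right $\mathcal{A}$-flat and $\eta_f$ is right $\mathcal{A}$-pure, then the map $\Gamma_f:\mathbf{I}^l_{\mathbb{B}(\mathcal{A},\mathcal{A})}(S_f)\to\mathrm{End}_{\mathcal{B}}(\mathfrak{C}_f,\mathfrak{C}_f)$ is an isomorphism of monoids. (ii) If $f^*$ is left $\mathcal{A}$-flat and $\eta_f$ is left $\mathcal{A}$-pure, then the map $\Gamma_{f^*}:(\mathbf{I}^r_{\mathbb{B}(\mathcal{A},\mathcal{A})}(S_f))^{\mathrm{op}}\to\mathrm{End}_{\mathcal{B}}(\mathfrak{C}_f,\mathfrak{C}_f)$ is an isomorphism of monoids.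
   Context: In a bicategory, the horizontal composite of $f:\mathcal{A}\to\mathcal{B}$ and $g:\mathcal{B}\to\mathcal{C}$ is written $g\otimes f$; a 1-cell also denotes its identity 2-cell; associativity and unit constraints are suppressed below. An adjunction $\eta_f,\varepsilon_f:f\dashv f^*$ consists of 2-cells $\eta_f:1_{\mathcal{A}}\to f^*\otimes f$, $\varepsilon_f:f\otimes f^*\to 1_{\mathcal{B}}$ satisfying the triangle identities. For a 0-cell $\mathcal{C}$, a 1-cell $g:\mathcal{X}\to\mathcal{Y}$ is right (resp. left) $\mathcal{C}$-flat if the functor $g\otimes-:\mathbb{B}(\mathcal{C},\mathcal{X})\to\mathbb{B}(\mathcal{C},\mathcal{Y})$ (resp. $-\otimes g:\mathbb{B}(\mathcal{Y},\mathcal{C})\to\mathbb{B}(\mathcal{X},\mathcal{C})$) preserves equalizers. A 2-cell $\tau:g\to g':\mathcal{X}\to\mathcal{Y}$ is right (resp. left) $\mathcal{C}$-pure if for every 1-cell $h:\mathcal{C}\to\mathcal{X}$ (resp. $h:\mathcal{Y}\to\mathcal{C}$) the morphism $\tau\otimes h$ (resp. $h\otimes\tau$) is a regular monomorphism in $\mathbb{B}(\mathcal{C},\mathcal{Y})$ (resp. $\mathbb{B}(\mathcal{X},\mathcal{C})$). $S_f=(f^*\otimes f,\ f^*\otimes\varepsilon_f\otimes f,\ \eta_f)$ (object, multiplication, unit) is a monoid in the monoidal category $\mathbb{B}(\mathcal{A},\mathcal{A})$; $\mathfrak{C}_f=(f\otimes f^*,\ f\otimes\eta_f\otimes f^*,\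 \varepsilon_f)$ (object, comultiplication, counit) is a comonoid in $\mathbb{B}(\mathcal{B},\mathcal{B})$; $\mathrm{End}_{\mathcal{B}}(\mathfrak{C}_f,\mathfrak{C}_f)$ is the monoid, under composition, of its comonoid endomorphisms. For a monoid $\mathbb{S}=(S,e_S,m_S)$ in a monoidal category $\mathcal{V}$ with unit object $I$, $\mathbf{I}^l_{\mathcal{V}}(\mathbb{S})$ (resp. $\mathbf{I}^r_{\mathcal{V}}(\mathbb{S})$) is the class of subobjects $[(J,i_J:J\to S)]$ of $S$ such that $m_S\cdot(S\otimes i_J):S\otimes J\to S$ (resp. $m_S\cdot(i_J\otimes S):J\otimes S\to S$) is an isomorphism. Under the hypotheses of (i) (resp. (ii)), $\mathbf{I}^l_{\mathbb{B}(\mathcal{A},\mathcal{A})}(S_f)$ (resp. $\mathbf{I}^r_{\mathbb{B}(\mathcal{A},\mathcal{A})}(S_f)$) is a monoid with product $[(J_1,i_{J_1})]\cdot[(J_2,i_{J_2})]=[(J_1\otimes J_2,\,m_S\cdot(i_{J_1}\otimes i_{J_2}))]$ and unit $[(I,e_S)]$, where $(S,e_S,m_S)=(f^*\otimes f,\eta_f,f^*\otimes\varepsilon_f\otimes f)$ and $I=1_{\mathcal{A}}$. $\Gamma_f$ sends $[(h,i_h)]$ to $(f\otimes f^*\otimes\varepsilon_f)\cdot(f\otimes i_h\otimes f^* )\cdot(\xi_{i_h}^{-1}\otimes f^* )$, where $\xi_{i_h}=(\varepsilon_f\otimes f)\cdot(f\otimes i_h):f\otimes h\to f$ (invertible). $\Gamma_{f^*}$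 sends $[(h,i_h)]$ to $(\varepsilon_f\otimes f\otimes f^* )\cdot(f\otimes i_h\otimes f^* )\cdot(f\otimes\xi_{i_h}^{-1})$, where $\xi_{i_h}=(f^*\otimes\varepsilon_f)\cdot(i_h\otimes f^* ):h\otimes f^*\to f^*$ (invertible).
   Formalization: The formal theorem additionally assumes that the hom-category B(A,A) has equalizers; without this, surjectivity of Γ_f can fail even when f is right A-flat and η_f is right A-pure. *)

theory Defs
  imports "HOL-Algebra.Group"
begin

section \<open>Bicategories\<close>

text \<open>
  A bicategory is given by its sets of 0-cells, 1-cells and 2-cells.  Every 1-cell has a source and
  a target 0-cell, every 2-cell a domain and a codomain 1-cell, so that the hom-category
  \<open>\<bbbB>(X, Y)\<close> consists of the 1-cells with source \<open>X\<close> and target \<open>Y\<close> and all 2-cells between them.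

  Compositions are written in applicative order: \<open>g \<odot> f\<close> is the horizontal composite of
  \<open>f : X \<rightarrow> Y\<close> and \<open>g : Y \<rightarrow> Z\<close>, \<open>\<beta> \<star> \<alpha>\<close> is the corresponding operation on 2-cells, and \<open>\<beta> \<cdot> \<alpha>\<close> is the
  vertical composite (first \<open>\<alpha>\<close>, then \<open>\<beta>\<close>).  The identity 1-cell of \<open>X\<close> is \<open>\<U> X\<close>, the identity
  2-cell of \<open>f\<close> is \<open>\<iota> f\<close>, and \<open>\<a> h g f : (h \<odot> g) \<odot> f \<rightarrow> h \<odot> (g \<odot> f)\<close>, \<open>\<l> f : \<U> Y \<odot> f \<rightarrow> f\<close>,
  \<open>\<r> f : f \<odot> \<U> X \<rightarrow> f\<close> are the associativity and unit constraints.
\<close>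

record ('o, 'm, 'c) bicat =
  Cell0 :: "'o set"
  Cell1 :: "'m set"
  Cell2 :: "'c set"
  src :: "'m \<Rightarrow> 'o"
  trg :: "'m \<Rightarrow> 'o"
  dom2 :: "'c \<Rightarrow> 'm"
  cod2 :: "'c \<Rightarrow> 'm"
  id1 :: "'o \<Rightarrow> 'm"  (\<open>\<U>\<index>\<close>)
  id2 :: "'m \<Rightarrow> 'c"  (\<open>\<iota>\<index>\<close>)
  comp1 :: "'m \<Rightarrow> 'm \<Rightarrow> 'm"  (infixr \<open>\<odot>\<index>\<close> 75)
  hcomp :: "'c \<Rightarrow> 'c \<Rightarrow> 'c"  (infixr \<open>\<star>\<index>\<close> 75)
  vcomp :: "'c \<Rightarrow> 'c \<Rightarrow> 'c"  (infixr \<open>\<cdot>\<index>\<close> 70)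
  assoc :: "'m \<Rightarrow> 'm \<Rightarrow> 'm \<Rightarrow> 'c"  (\<open>\<a>\<index>\<close>)
  lunit :: "'m \<Rightarrow> 'c"  (\<open>\<l>\<index>\<close>)
  runit :: "'m \<Rightarrow> 'c"  (\<open>\<r>\<index>\<close>)

context
  fixes \<BB> :: "('o, 'm, 'c, 'z) bicat_scheme" (structure)
begin

definition in_hom1 :: "'m \<Rightarrow> 'o \<Rightarrow> 'o \<Rightarrow> bool" where
  "in_hom1 f X Y \<longleftrightarrow> f \<in> Cell1 \<BB> \<and> src \<BB> f = X \<and> trg \<BB> f = Y"

definition in_hom2 :: "'c \<Rightarrow> 'm \<Rightarrow> 'm \<Rightarrow> bool" where
  "in_hom2 \<alpha> f g \<longleftrightarrow> \<alpha> \<in> Cell2 \<BB> \<and> dom2 \<BB> \<alpha> = f \<and> cod2 \<BB> \<alpha> = g"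

definition inverse2 :: "'c \<Rightarrow> 'c \<Rightarrow> bool" where
  "inverse2 \<alpha> \<beta> \<longleftrightarrow>
     in_hom2 \<alpha> (dom2 \<BB> \<alpha>) (cod2 \<BB> \<alpha>) \<and> in_hom2 \<beta> (cod2 \<BB> \<alpha>) (dom2 \<BB> \<alpha>) \<and>
     \<beta> \<cdot> \<alpha> = \<iota> (dom2 \<BB> \<alpha>) \<and> \<alpha> \<cdot> \<beta> = \<iota> (cod2 \<BB> \<alpha>)"

definition iso2 :: "'c \<Rightarrow> bool" where
  "iso2 \<alpha> \<longleftrightarrow> (\<exists>\<beta>. inverse2 \<alpha> \<beta>)"

definition inv2 :: "'c \<Rightarrow> 'c" where
  "inv2 \<alpha> = (THE \<beta>. inverse2 \<alpha> \<beta>)"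

end

locale bicategory =
  fixes \<BB> :: "('o, 'm, 'c, 'z) bicat_scheme" (structure)
  assumes src_trg: "f \<in> Cell1 \<BB> \<Longrightarrow> src \<BB> f \<in> Cell0 \<BB> \<and> trg \<BB> f \<in> Cell0 \<BB>"
    and dom_cod: "\<alpha> \<in> Cell2 \<BB> \<Longrightarrow> dom2 \<BB> \<alpha> \<in> Cell1 \<BB> \<and> cod2 \<BB> \<alpha> \<in> Cell1 \<BB> \<and>
        src \<BB> (dom2 \<BB> \<alpha>) = src \<BB> (cod2 \<BB> \<alpha>) \<and> trg \<BB> (dom2 \<BB> \<alpha>) = trg \<BB> (cod2 \<BB> \<alpha>)"
    \<comment> \<open>the hom-categories\<close>
    and id2_hom: "f \<in> Cell1 \<BB> \<Longrightarrow> in_hom2 \<BB> (\<iota> f) f f"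
    and vcomp_hom: "\<lbrakk>in_hom2 \<BB> \<alpha> f g; in_hom2 \<BB> \<beta> g h\<rbrakk> \<Longrightarrow> in_hom2 \<BB> (\<beta> \<cdot> \<alpha>) f h"
    and vcomp_id_left: "in_hom2 \<BB> \<alpha> f g \<Longrightarrow> \<iota> g \<cdot> \<alpha> = \<alpha>"
    and vcomp_id_right: "in_hom2 \<BB> \<alpha> f g \<Longrightarrow> \<alpha> \<cdot> \<iota> f = \<alpha>"
    and vcomp_assoc: "\<lbrakk>in_hom2 \<BB> \<alpha> f g; in_hom2 \<BB> \<beta> g h; in_hom2 \<BB> \<gamma> h k\<rbrakk>
        \<Longrightarrow> (\<gamma> \<cdot> \<beta>) \<cdot> \<alpha> = \<gamma> \<cdot> (\<beta> \<cdot> \<alpha>)"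
    \<comment> \<open>horizontal composition is a functor\<close>
    and id1_hom: "X \<in> Cell0 \<BB> \<Longrightarrow> in_hom1 \<BB> (\<U> X) X X"
    and comp1_hom: "\<lbrakk>in_hom1 \<BB> f X Y; in_hom1 \<BB> g Y Z\<rbrakk> \<Longrightarrow> in_hom1 \<BB> (g \<odot> f) X Z"
    and hcomp_hom: "\<lbrakk>in_hom2 \<BB> \<alpha> f f'; in_hom2 \<BB> \<beta> g g'; trg \<BB> f = src \<BB> g\<rbrakk>
        \<Longrightarrow> in_hom2 \<BB> (\<beta> \<star> \<alpha>) (g \<odot> f) (g' \<odot> f')"
    and hcomp_id: "\<lbrakk>in_hom1 \<BB> f X Y; in_hom1 \<BB> g Y Z\<rbrakk> \<Longrightarrow> \<iota> g \<star> \<iota> f = \<iota> (g \<odot> f)"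
    and interchange: "\<lbrakk>in_hom2 \<BB> \<alpha> f f'; in_hom2 \<BB> \<alpha>' f' f''; in_hom2 \<BB> \<beta> g g'; in_hom2 \<BB> \<beta>' g' g'';
          trg \<BB> f = src \<BB> g\<rbrakk>
        \<Longrightarrow> (\<beta>' \<cdot> \<beta>) \<star> (\<alpha>' \<cdot> \<alpha>) = (\<beta>' \<star> \<alpha>') \<cdot> (\<beta> \<star> \<alpha>)"
    \<comment> \<open>the constraints are natural isomorphisms\<close>
    and assoc_hom: "\<lbrakk>in_hom1 \<BB> f W X; in_hom1 \<BB> g X Y; in_hom1 \<BB> h Y Z\<rbrakk>
        \<Longrightarrow> in_hom2 \<BB> (\<a> h g f) ((h \<odot> g) \<odot> f) (h \<odot> (g \<odot> f)) \<and> iso2 \<BB> (\<a> h g f)"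
    and lunit_hom: "in_hom1 \<BB> f X Y \<Longrightarrow> in_hom2 \<BB> (\<l> f) (\<U> Y \<odot> f) f \<and> iso2 \<BB> (\<l> f)"
    and runit_hom: "in_hom1 \<BB> f X Y \<Longrightarrow> in_hom2 \<BB> (\<r> f) (f \<odot> \<U> X) f \<and> iso2 \<BB> (\<r> f)"
    and assoc_natural: "\<lbrakk>in_hom2 \<BB> \<alpha> f f'; in_hom2 \<BB> \<beta> g g'; in_hom2 \<BB> \<gamma> h h';
          trg \<BB> f = src \<BB> g; trg \<BB> g = src \<BB> h\<rbrakk>
        \<Longrightarrow> \<a> h' g' f' \<cdot> ((\<gamma> \<star> \<beta>) \<star> \<alpha>) = (\<gamma> \<star> (\<beta> \<star> \<alpha>)) \<cdot> \<a> h g f"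
    and lunit_natural: "in_hom2 \<BB> \<alpha> f f' \<Longrightarrow> \<l> f' \<cdot> (\<iota> (\<U> (trg \<BB> f)) \<star> \<alpha>) = \<alpha> \<cdot> \<l> f"
    and runit_natural: "in_hom2 \<BB> \<alpha> f f' \<Longrightarrow> \<r> f' \<cdot> (\<alpha> \<star> \<iota> (\<U> (src \<BB> f))) = \<alpha> \<cdot> \<r> f"
    \<comment> \<open>coherence\<close>
    and pentagon: "\<lbrakk>in_hom1 \<BB> f V W; in_hom1 \<BB> g W X; in_hom1 \<BB> h X Y; in_hom1 \<BB> k Y Z\<rbrakk>
        \<Longrightarrow> (\<iota> k \<star> \<a> h g f) \<cdot> \<a> k (h \<odot> g) f \<cdot> (\<a> k h g \<star> \<iota> f) = \<a> k h (g \<odot> f) \<cdot> \<a> (k \<odot> h) g f"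
    and triangle: "\<lbrakk>in_hom1 \<BB> f X Y; in_hom1 \<BB> g Y Z\<rbrakk>
        \<Longrightarrow> (\<iota> g \<star> \<l> f) \<cdot> \<a> g (\<U> Y) f = \<r> g \<star> \<iota> f"

context
  fixes \<BB> :: "('o, 'm, 'c, 'z) bicat_scheme" (structure)
begin

section \<open>Equalizers, flatness and purity\<close>

text \<open>
  Vertically composable 2-cells all lie in one and the same hom-category, so the following are
  the notions of monomorphism, equalizer and regular monomorphism in the hom-category
  that contains the given 2-cells.
\<close>

definition mono2 :: "'c \<Rightarrow> bool" where
  "mono2 i \<longleftrightarrow> i \<in> Cell2 \<BB> \<and>
     (\<forall>u v x. in_hom2 \<BB> u x (dom2 \<BB> i) \<and> in_hom2 \<BB> v x (dom2 \<BB> i) \<and> i \<cdot> u = i \<cdot> v \<longrightarrow> u = v)"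

definition is_equalizer :: "'c \<Rightarrow> 'c \<Rightarrow> 'c \<Rightarrow> bool" where
  "is_equalizer e u v \<longleftrightarrow> (\<exists>x y z. in_hom2 \<BB> e x y \<and> in_hom2 \<BB> u y z \<and> in_hom2 \<BB> v y z \<and>
     u \<cdot> e = v \<cdot> e \<and>
     (\<forall>w t. in_hom2 \<BB> t w y \<and> u \<cdot> t = v \<cdot> t \<longrightarrow> (\<exists>!s. in_hom2 \<BB> s w x \<and> e \<cdot> s = t)))"

definition regular_mono :: "'c \<Rightarrow> bool" where
  "regular_mono e \<longleftrightarrow> (\<exists>u v. is_equalizer e u v)"

text \<open>
  Preservation of equalizers alone does not provide any.  Surjectivity of the comparison maps
  needs the existence of equalizers in \<open>\<bbbB>(A, A)\<close>, which is expressed as follows.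
\<close>

definition hom_has_equalizers :: "'o \<Rightarrow> 'o \<Rightarrow> bool" where
  "hom_has_equalizers X Y \<longleftrightarrow>
     (\<forall>y z u v. in_hom1 \<BB> y X Y \<and> in_hom2 \<BB> u y z \<and> in_hom2 \<BB> v y z \<longrightarrow> (\<exists>e. is_equalizer e u v))"

definition right_flat :: "'o \<Rightarrow> 'm \<Rightarrow> bool" where
  "right_flat C g \<longleftrightarrow>
     (\<forall>e u v. is_equalizer e u v \<and> in_hom1 \<BB> (dom2 \<BB> e) C (src \<BB> g) \<longrightarrow>
        is_equalizer (\<iota> g \<star> e) (\<iota> g \<star> u) (\<iota> g \<star> v))"

definition left_flat :: "'o \<Rightarrow> 'm \<Rightarrow> bool" where
  "left_flat C g \<longleftrightarrow>
     (\<forall>e u v. is_equalizer e u v \<and> in_hom1 \<BB> (dom2 \<BB> e) (trg \<BB> g) C \<longrightarrow>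
        is_equalizer (e \<star> \<iota> g) (u \<star> \<iota> g) (v \<star> \<iota> g))"

definition right_pure :: "'o \<Rightarrow> 'c \<Rightarrow> bool" where
  "right_pure C \<tau> \<longleftrightarrow> (\<forall>h. in_hom1 \<BB> h C (src \<BB> (dom2 \<BB> \<tau>)) \<longrightarrow> regular_mono (\<tau> \<star> \<iota> h))"

definition left_pure :: "'o \<Rightarrow> 'c \<Rightarrow> bool" where
  "left_pure C \<tau> \<longleftrightarrow> (\<forall>h. in_hom1 \<BB> h (trg \<BB> (dom2 \<BB> \<tau>)) C \<longrightarrow> regular_mono (\<iota> h \<star> \<tau>))"

section \<open>Adjunctions, with their monoid and comonoid\<close>

text \<open>
  From here on the constraints that are usually suppressed are written out.  In each formula they
  are inserted between the bracketings of the source and target of the neighbouring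
  2-cells; by coherence the choice of the path of constraints is immaterial.
\<close>

definition adjunction :: "'o \<Rightarrow> 'o \<Rightarrow> 'm \<Rightarrow> 'm \<Rightarrow> 'c \<Rightarrow> 'c \<Rightarrow> bool" where
  "adjunction A B f fs \<eta> \<epsilon> \<longleftrightarrow>
     in_hom1 \<BB> f A B \<and> in_hom1 \<BB> fs B A \<and>
     in_hom2 \<BB> \<eta> (\<U> A) (fs \<odot> f) \<and> in_hom2 \<BB> \<epsilon> (f \<odot> fs) (\<U> B) \<and>
     \<l> f \<cdot> (\<epsilon> \<star> \<iota> f) \<cdot> inv2 \<BB> (\<a> f fs f) \<cdot> (\<iota> f \<star> \<eta>) \<cdot> inv2 \<BB> (\<r> f) = \<iota> f \<and>
     \<r> fs \<cdot> (\<iota> fs \<star> \<epsilon>) \<cdot> \<a> fs f fs \<cdot> (\<eta> \<star> \<iota> fs) \<cdot> inv2 \<BB> (\<l> fs) = \<iota> fs"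

text \<open>The multiplication \<open>f\<^sup>* \<otimes> \<epsilon> \<otimes> f\<close> of the monoid \<open>S\<^sub>f\<close> with object \<open>f\<^sup>* \<otimes> f\<close> and unit \<open>\<eta>\<close>.\<close>

definition adj_mult :: "'m \<Rightarrow> 'm \<Rightarrow> 'c \<Rightarrow> 'c" where
  "adj_mult f fs \<epsilon> =
     (\<iota> fs \<star> \<l> f) \<cdot> (\<iota> fs \<star> (\<epsilon> \<star> \<iota> f)) \<cdot> (\<iota> fs \<star> inv2 \<BB> (\<a> f fs f)) \<cdot> \<a> fs f (fs \<odot> f)"

text \<open>
  The canonical isomorphism \<open>(f \<otimes> (f\<^sup>* \<otimes> f)) \<otimes> f\<^sup>* \<rightarrow> (f \<otimes> f\<^sup>*) \<otimes> (f \<otimes> f\<^sup>*)\<close>.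
\<close>

definition rebracket :: "'m \<Rightarrow> 'm \<Rightarrow> 'c" where
  "rebracket f fs = \<a> (f \<odot> fs) f fs \<cdot> (inv2 \<BB> (\<a> f fs f) \<star> \<iota> fs)"

text \<open>
  The comultiplication \<open>f \<otimes> \<eta> \<otimes> f\<^sup>*\<close> of the comonoid \<open>\<CC>\<^sub>f\<close> with object \<open>f \<otimes> f\<^sup>*\<close> and counit \<open>\<epsilon>\<close>.
\<close>

definition adj_comult :: "'m \<Rightarrow> 'm \<Rightarrow> 'c \<Rightarrow> 'c" where
  "adj_comult f fs \<eta> = rebracket f fs \<cdot> ((\<iota> f \<star> \<eta>) \<star> \<iota> fs) \<cdot> (inv2 \<BB> (\<r> f) \<star> \<iota> fs)"

text \<open>The monoid of endomorphisms of a comonoid \<open>(C, \<delta>, \<epsilon>)\<close> in a monoidal category \<open>\<bbbB>(B, B)\<close>.\<close>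

definition comonoid_End :: "'m \<Rightarrow> 'c \<Rightarrow> 'c \<Rightarrow> 'c monoid" where
  "comonoid_End C \<delta> \<epsilon> =
     \<lparr>carrier = {\<phi>. in_hom2 \<BB> \<phi> C C \<and> \<delta> \<cdot> \<phi> = (\<phi> \<star> \<phi>) \<cdot> \<delta> \<and> \<epsilon> \<cdot> \<phi> = \<epsilon>},
      mult = (\<cdot>),
      one = \<iota> C\<rparr>"

section \<open>The monoids of subobjects\<close>

text \<open>
  A subobject \<open>[(J, i)]\<close> of \<open>S\<close> is represented by the set of all monomorphisms into \<open>S\<close> that
  are equivalent to \<open>i\<close>; the object \<open>J\<close> is recovered as the domain of \<open>i\<close>.
\<close>

definition sub_equiv :: "'m \<Rightarrow> ('c \<times> 'c) set" where
  "sub_equiv S = {(i, j). mono2 i \<and> mono2 j \<and> cod2 \<BB> i = S \<and> cod2 \<BB> j = S \<and>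
     (\<exists>k. iso2 \<BB> k \<and> in_hom2 \<BB> k (dom2 \<BB> i) (dom2 \<BB> j) \<and> j \<cdot> k = i)}"

definition subobject :: "'m \<Rightarrow> 'c \<Rightarrow> 'c set" where
  "subobject S i = sub_equiv S `` {i}"

text \<open>
  Here \<open>(S, e, m)\<close> is a monoid in a monoidal category \<open>\<bbbB>(A, A)\<close>.  The product of two classes is
  given by representatives, \<open>the_elem\<close> picking the common value of all choices.
\<close>

definition sub_mult :: "'m \<Rightarrow> 'c \<Rightarrow> 'c set \<Rightarrow> 'c set \<Rightarrow> 'c set" where
  "sub_mult S m P Q = the_elem {subobject S (m \<cdot> (i \<star> j)) | i j. i \<in> P \<and> j \<in> Q}"

definition I_left :: "'m \<Rightarrow> 'c \<Rightarrow> 'c \<Rightarrow> 'c set monoid" where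
  "I_left S e m =
     \<lparr>carrier = {subobject S i | i. mono2 i \<and> cod2 \<BB> i = S \<and> iso2 \<BB> (m \<cdot> (\<iota> S \<star> i))},
      mult = sub_mult S m,
      one = subobject S e\<rparr>"

definition I_right :: "'m \<Rightarrow> 'c \<Rightarrow> 'c \<Rightarrow> 'c set monoid" where
  "I_right S e m =
     \<lparr>carrier = {subobject S i | i. mono2 i \<and> cod2 \<BB> i = S \<and> iso2 \<BB> (m \<cdot> (i \<star> \<iota> S))},
      mult = sub_mult S m,
      one = subobject S e\<rparr>"

section \<open>The comparison maps\<close>

text \<open>\<open>\<xi>\<^sub>i : f \<otimes> h \<rightarrow> f\<close> and \<open>\<xi>\<^sub>i : h \<otimes> f\<^sup>* \<rightarrow> f\<^sup>*\<close> for \<open>i : h \<rightarrow> f\<^sup>* \<otimes> f\<close>.\<close>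

definition xi_left :: "'m \<Rightarrow> 'm \<Rightarrow> 'c \<Rightarrow> 'c \<Rightarrow> 'c" where
  "xi_left f fs \<epsilon> i = \<l> f \<cdot> (\<epsilon> \<star> \<iota> f) \<cdot> inv2 \<BB> (\<a> f fs f) \<cdot> (\<iota> f \<star> i)"

definition xi_right :: "'m \<Rightarrow> 'm \<Rightarrow> 'c \<Rightarrow> 'c \<Rightarrow> 'c" where
  "xi_right f fs \<epsilon> i = \<r> fs \<cdot> (\<iota> fs \<star> \<epsilon>) \<cdot> \<a> fs f fs \<cdot> (i \<star> \<iota> fs)"

text \<open>
  \<open>\<Gamma>\<^sub>f\<close> and \<open>\<Gamma>\<^bsub>f\<^sup>*\<^esub>\<close> on a class \<open>P\<close> are again the common value on all representatives.
\<close>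

definition Gamma_left :: "'m \<Rightarrow> 'm \<Rightarrow> 'c \<Rightarrow> 'c set \<Rightarrow> 'c" where
  "Gamma_left f fs \<epsilon> P = the_elem
     ((\<lambda>i. \<r> (f \<odot> fs) \<cdot> (\<iota> (f \<odot> fs) \<star> \<epsilon>) \<cdot> rebracket f fs \<cdot>
             ((\<iota> f \<star> i) \<star> \<iota> fs) \<cdot> (inv2 \<BB> (xi_left f fs \<epsilon> i) \<star> \<iota> fs)) ` P)"

definition Gamma_right :: "'m \<Rightarrow> 'm \<Rightarrow> 'c \<Rightarrow> 'c set \<Rightarrow> 'c" where
  "Gamma_right f fs \<epsilon> P = the_elem
     ((\<lambda>i. \<l> (f \<odot> fs) \<cdot> (\<epsilon> \<star> \<iota> (f \<odot> fs)) \<cdot> inv2 \<BB> (\<a> f fs (f \<odot> fs)) \<cdot> (\<iota> f \<star> \<a> fs f fs) \<cdot>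
             (\<iota> f \<star> (i \<star> \<iota> fs)) \<cdot> (\<iota> f \<star> inv2 \<BB> (xi_right f fs \<epsilon> i))) ` P)"

end

section \<open>Isomorphisms of monoids\<close>

definition opposite_monoid :: "'a monoid \<Rightarrow> 'a monoid" where
  "opposite_monoid M = \<lparr>carrier = carrier M, mult = (\<lambda>x y. y \<otimes>\<^bsub>M\<^esub> x), one = \<one>\<^bsub>M\<^esub>\<rparr>"

text \<open>The library's \<open>iso\<close> asks neither that the structures are monoids nor that units are preserved.\<close>

definition monoid_iso :: "'a monoid \<Rightarrow> 'b monoid \<Rightarrow> ('a \<Rightarrow> 'b) \<Rightarrow> bool" where
  "monoid_iso M N \<phi> \<longleftrightarrow> monoid M \<and> monoid N \<and> \<phi> \<in> iso M N \<and> \<phi> \<one>\<^bsub>M\<^esub> = \<one>\<^bsub>N\<^esub>"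

end

theory Submission
  imports Defs
begin

text \<open>
  Whiskering with the two 1-cells gives an adjunction of functors \<open>F = f \<otimes> -\<close> and \<open>G = f\<^sup>* \<otimes> -\<close>
  between \<open>\<bbbB>(A, A)\<close> and \<open>\<bbbB>(A, B)\<close>, and \<open>F\<close> is comonadic as far as the theorem needs it.  Both sides
  of the isomorphism are descriptions of the coalgebra structures \<open>c : f \<rightarrow> FG f\<close> on the object \<open>f\<close>.

  \<^item> Comonoid endomorphisms.  Since \<open>- \<otimes> f\<^sup>*\<close> is left adjoint to \<open>- \<otimes> f\<close>, a 2-cell
    \<open>\<phi> : f \<otimes> f\<^sup>* \<rightarrow> f \<otimes> f\<^sup>*\<close> corresponds to its mate \<open>c : f \<rightarrow> f \<otimes> f\<^sup>* \<otimes> f\<close>.  Under this bijection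
    compatibility of \<open>\<phi>\<close> with counit and comultiplication says precisely that \<open>c\<close> is counital
    and coassociative (\<open>counital_iff\<close>, \<open>coassociative_iff\<close>).

  \<^item> Subobjects.  The multiplication of \<open>S\<^sub>f\<close> turns \<open>S \<otimes> i\<close> into \<open>G \<xi>\<^sub>i\<close>, and \<open>G\<close> reflects the relevant
    isomorphisms because the counit is split epi at \<open>F J\<close> and at \<open>f\<close>
    (\<open>counit_reflects_iso\<close>).  So the defining condition says that \<open>\<xi>\<^sub>i : F J \<rightarrow> f\<close> is invertible, and
    the cofree coalgebra \<open>F J\<close> then gives \<open>f\<close> the structure \<open>c = F i \<cdot> \<xi>\<^sub>i\<^sup>-\<^sup>1\<close>.  As in Beck's theorem,
    \<open>i\<close> is recovered from \<open>c\<close> as the equalizer of the unit at \<open>G f\<close> and \<open>G c\<close>:  purity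
    makes \<open>i\<close> have that universal property (\<open>invertible_factor\<close>), and for a
    given \<open>c\<close> an equalizer exists in \<open>\<bbbB>(A, A)\<close>, with flatness forcing its \<open>\<xi>\<close> to be invertible
    (\<open>coact_surj\<close>).  Two such \<open>i\<close> with the same \<open>c\<close> therefore differ by a unique isomorphism, so a
    subobject is the same thing as a fibre of \<open>i \<mapsto> c\<close> (\<open>subobject_eq_fibre\<close>).

  \<open>\<Gamma>\<^sub>f\<close> is the composite of the two bijections.  It is multiplicative by a direct calculation
  with \<open>\<xi>\<close> of a product (\<open>invertible_mult\<close>), and the monoid axioms for subobjects are inherited from
  those of the endomorphisms.

  The second half is the first one in the bicategory with reversed 1-cells, where \<open>f\<^sup>*\<close> is left adjoint
  to \<open>f\<close> with the same unit and counit.  Reversal leaves the comonoid unchanged, keeps the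
  multiplication of \<open>S\<^sub>f\<close> as a 2-cell while exchanging the order of products of subobjects,
  and carries \<open>\<Gamma>\<^sub>f\<close> to \<open>\<Gamma>\<^bsub>f\<^sup>*\<^esub>\<close>.
\<close>

section \<open>Calculating with 2-cells\<close>

text \<open>
  The axioms are first restated with equations between sources and targets as premises, so that
  the simplifier can check composability by computing domains and codomains.
\<close>

context bicategory
begin

lemma comp1_cell [simp]:
  assumes "f \<in> Cell1 \<BB>" "g \<in> Cell1 \<BB>" "trg \<BB> f = src \<BB> g"
  shows "g \<odot> f \<in> Cell1 \<BB>" "src \<BB> (g \<odot> f) = src \<BB> f" "trg \<BB> (g \<odot> f) = trg \<BB> g"
  using comp1_hom[of f "src \<BB> f" "trg \<BB> f" g "trg \<BB> g"] assms by (auto simp: in_hom1_def)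

lemma id1_cell [simp]:
  assumes "X \<in> Cell0 \<BB>"
  shows "\<U> X \<in> Cell1 \<BB>" "src \<BB> (\<U> X) = X" "trg \<BB> (\<U> X) = X"
  using id1_hom[OF assms] by (auto simp: in_hom1_def)

lemma src_trg_cell [simp]:
  assumes "f \<in> Cell1 \<BB>" shows "src \<BB> f \<in> Cell0 \<BB>" "trg \<BB> f \<in> Cell0 \<BB>"
  using src_trg assms by auto

lemma dom_cod_cell [simp]:
  assumes "\<alpha> \<in> Cell2 \<BB>"
  shows "dom2 \<BB> \<alpha> \<in> Cell1 \<BB>" "cod2 \<BB> \<alpha> \<in> Cell1 \<BB>"
    "src \<BB> (cod2 \<BB> \<alpha>) = src \<BB> (dom2 \<BB> \<alpha>)" "trg \<BB> (cod2 \<BB> \<alpha>) = trg \<BB> (dom2 \<BB> \<alpha>)"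
  using dom_cod[OF assms] by auto

lemma id2_cell [simp]:
  assumes "f \<in> Cell1 \<BB>"
  shows "\<iota> f \<in> Cell2 \<BB>" "dom2 \<BB> (\<iota> f) = f" "cod2 \<BB> (\<iota> f) = f"
  using id2_hom[OF assms] by (auto simp: in_hom2_def)

lemma vcomp_cell [simp]:
  assumes "\<alpha> \<in> Cell2 \<BB>" "\<beta> \<in> Cell2 \<BB>" "cod2 \<BB> \<alpha> = dom2 \<BB> \<beta>"
  shows "\<beta> \<cdot> \<alpha> \<in> Cell2 \<BB>" "dom2 \<BB> (\<beta> \<cdot> \<alpha>) = dom2 \<BB> \<alpha>" "cod2 \<BB> (\<beta> \<cdot> \<alpha>) = cod2 \<BB> \<beta>"
  using vcomp_hom[of \<alpha> "dom2 \<BB> \<alpha>" "cod2 \<BB> \<alpha>" \<beta> "cod2 \<BB> \<beta>"] assms by (auto simp: in_hom2_def)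

lemma hcomp_cell [simp]:
  assumes "\<alpha> \<in> Cell2 \<BB>" "\<beta> \<in> Cell2 \<BB>" "trg \<BB> (dom2 \<BB> \<alpha>) = src \<BB> (dom2 \<BB> \<beta>)"
  shows "\<beta> \<star> \<alpha> \<in> Cell2 \<BB>" "dom2 \<BB> (\<beta> \<star> \<alpha>) = dom2 \<BB> \<beta> \<odot> dom2 \<BB> \<alpha>"
    "cod2 \<BB> (\<beta> \<star> \<alpha>) = cod2 \<BB> \<beta> \<odot> cod2 \<BB> \<alpha>"
  using hcomp_hom[of \<alpha> "dom2 \<BB> \<alpha>" "cod2 \<BB> \<alpha>" \<beta> "dom2 \<BB> \<beta>" "cod2 \<BB> \<beta>"] assms
  by (auto simp: in_hom2_def)

lemma vcomp_id [simp]: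
  assumes "\<alpha> \<in> Cell2 \<BB>"
  shows "cod2 \<BB> \<alpha> = g \<Longrightarrow> \<iota> g \<cdot> \<alpha> = \<alpha>" "dom2 \<BB> \<alpha> = f \<Longrightarrow> \<alpha> \<cdot> \<iota> f = \<alpha>"
  using vcomp_id_left vcomp_id_right assms by (auto simp: in_hom2_def)

lemma vcomp_reassoc:
  assumes "\<alpha> \<in> Cell2 \<BB>" "\<beta> \<in> Cell2 \<BB>" "\<gamma> \<in> Cell2 \<BB>"
    "cod2 \<BB> \<alpha> = dom2 \<BB> \<beta>" "cod2 \<BB> \<beta> = dom2 \<BB> \<gamma>"
  shows "(\<gamma> \<cdot> \<beta>) \<cdot> \<alpha> = \<gamma> \<cdot> \<beta> \<cdot> \<alpha>"
  using vcomp_assoc[of \<alpha> "dom2 \<BB> \<alpha>" "cod2 \<BB> \<alpha>" \<beta> "cod2 \<BB> \<beta>" \<gamma> "cod2 \<BB> \<gamma>"] assms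
  by (auto simp: in_hom2_def)

text \<open>
Composites are kept associated to the right.  This turns an equation for two adjacent factors
into a rewrite rule for their occurrence at the head of a longer composite.
\<close>
lemma prolong:
  assumes "\<beta> \<cdot> \<alpha> = \<gamma>" "\<tau> \<in> Cell2 \<BB>" "\<alpha> \<in> Cell2 \<BB>" "\<beta> \<in> Cell2 \<BB>"
    "cod2 \<BB> \<tau> = dom2 \<BB> \<alpha>" "cod2 \<BB> \<alpha> = dom2 \<BB> \<beta>"
  shows "\<beta> \<cdot> \<alpha> \<cdot> \<tau> = \<gamma> \<cdot> \<tau>"
  using vcomp_reassoc[of \<tau> \<alpha> \<beta>] assms by simp

lemma hcomp_ids [simp]:
  assumes "f \<in> Cell1 \<BB>" "g \<in> Cell1 \<BB>" "trg \<BB> f = src \<BB> g"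
  shows "\<iota> g \<star> \<iota> f = \<iota> (g \<odot> f)"
  using hcomp_id[of f "src \<BB> f" "trg \<BB> f" g "trg \<BB> g"] assms by (auto simp: in_hom1_def)

lemma hcomp_vcomp:
  assumes "\<alpha> \<in> Cell2 \<BB>" "\<alpha>' \<in> Cell2 \<BB>" "\<beta> \<in> Cell2 \<BB>" "\<beta>' \<in> Cell2 \<BB>"
    "cod2 \<BB> \<alpha> = dom2 \<BB> \<alpha>'" "cod2 \<BB> \<beta> = dom2 \<BB> \<beta>'" "trg \<BB> (dom2 \<BB> \<alpha>) = src \<BB> (dom2 \<BB> \<beta>)"
  shows "(\<beta>' \<star> \<alpha>') \<cdot> (\<beta> \<star> \<alpha>) = (\<beta>' \<cdot> \<beta>) \<star> (\<alpha>' \<cdot> \<alpha>)"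
  using interchange[of \<alpha> "dom2 \<BB> \<alpha>" "cod2 \<BB> \<alpha>" \<alpha>' "cod2 \<BB> \<alpha>'"
      \<beta> "dom2 \<BB> \<beta>" "cod2 \<BB> \<beta>" \<beta>' "cod2 \<BB> \<beta>'"] assms
  by (auto simp: in_hom2_def)

lemma whisker_left:
  assumes "g \<in> Cell1 \<BB>" "\<alpha> \<in> Cell2 \<BB>" "\<beta> \<in> Cell2 \<BB>" "cod2 \<BB> \<alpha> = dom2 \<BB> \<beta>"
    "trg \<BB> (dom2 \<BB> \<alpha>) = src \<BB> g"
  shows "\<iota> g \<star> (\<beta> \<cdot> \<alpha>) = (\<iota> g \<star> \<beta>) \<cdot> (\<iota> g \<star> \<alpha>)"
  using assms by (subst hcomp_vcomp) auto

lemma whisker_right: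
  assumes "g \<in> Cell1 \<BB>" "\<alpha> \<in> Cell2 \<BB>" "\<beta> \<in> Cell2 \<BB>" "cod2 \<BB> \<alpha> = dom2 \<BB> \<beta>"
    "src \<BB> (dom2 \<BB> \<alpha>) = trg \<BB> g"
  shows "(\<beta> \<cdot> \<alpha>) \<star> \<iota> g = (\<beta> \<star> \<iota> g) \<cdot> (\<alpha> \<star> \<iota> g)"
  using assms by (subst hcomp_vcomp) auto

lemma whisker_exchange:
  assumes "\<alpha> \<in> Cell2 \<BB>" "\<beta> \<in> Cell2 \<BB>" "trg \<BB> (dom2 \<BB> \<alpha>) = src \<BB> (dom2 \<BB> \<beta>)"
    "cod2 \<BB> \<alpha> = x'" "dom2 \<BB> \<beta> = y"
  shows "(\<beta> \<star> \<iota> x') \<cdot> (\<iota> y \<star> \<alpha>) = (\<iota> (cod2 \<BB> \<beta>) \<star> \<alpha>) \<cdot> (\<beta> \<star> \<iota> (dom2 \<BB> \<alpha>))"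
  using assms by (auto simp: hcomp_vcomp)

lemma inverse2_unique:
  assumes "inverse2 \<BB> \<alpha> \<beta>" "inverse2 \<BB> \<alpha> \<gamma>" shows "\<beta> = \<gamma>"
proof -
  have "\<beta> = (\<gamma> \<cdot> \<alpha>) \<cdot> \<beta>" using assms by (auto simp: inverse2_def in_hom2_def)
  also have "\<dots> = \<gamma> \<cdot> \<alpha> \<cdot> \<beta>"
    using assms by (intro vcomp_reassoc) (auto simp: inverse2_def in_hom2_def)
  also have "\<dots> = \<gamma>" using assms by (auto simp: inverse2_def in_hom2_def)
  finally show ?thesis .
qed

lemma inv2_eq: "inverse2 \<BB> \<alpha> \<beta> \<Longrightarrow> inv2 \<BB> \<alpha> = \<beta>"
  unfolding inv2_def by (rule the_equality) (auto intro: inverse2_unique)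

lemma inverse2_inv2: "iso2 \<BB> \<alpha> \<Longrightarrow> inverse2 \<BB> \<alpha> (inv2 \<BB> \<alpha>)"
  using inv2_eq by (auto simp: iso2_def)

lemma iso2_cell: "iso2 \<BB> \<alpha> \<Longrightarrow> \<alpha> \<in> Cell2 \<BB>"
  by (auto simp: iso2_def inverse2_def in_hom2_def)

lemma inv2_cell [simp]:
  assumes "iso2 \<BB> \<alpha>"
  shows "inv2 \<BB> \<alpha> \<in> Cell2 \<BB>" "dom2 \<BB> (inv2 \<BB> \<alpha>) = cod2 \<BB> \<alpha>" "cod2 \<BB> (inv2 \<BB> \<alpha>) = dom2 \<BB> \<alpha>"
    "inv2 \<BB> \<alpha> \<cdot> \<alpha> = \<iota> (dom2 \<BB> \<alpha>)" "\<alpha> \<cdot> inv2 \<BB> \<alpha> = \<iota> (cod2 \<BB> \<alpha>)"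
  using inverse2_inv2[OF assms] by (auto simp: inverse2_def in_hom2_def)

lemma inv2_cancel [simp]:
  assumes "iso2 \<BB> \<alpha>" "\<tau> \<in> Cell2 \<BB>"
  shows "cod2 \<BB> \<tau> = dom2 \<BB> \<alpha> \<Longrightarrow> inv2 \<BB> \<alpha> \<cdot> \<alpha> \<cdot> \<tau> = \<tau>"
    "cod2 \<BB> \<tau> = cod2 \<BB> \<alpha> \<Longrightarrow> \<alpha> \<cdot> inv2 \<BB> \<alpha> \<cdot> \<tau> = \<tau>"
  using assms iso2_cell[OF assms(1)] by (simp_all flip: vcomp_reassoc)

lemma inverse2I:
  assumes "\<alpha> \<in> Cell2 \<BB>" "\<beta> \<in> Cell2 \<BB>" "dom2 \<BB> \<beta> = cod2 \<BB> \<alpha>" "cod2 \<BB> \<beta> = dom2 \<BB> \<alpha>"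
    "\<beta> \<cdot> \<alpha> = \<iota> (dom2 \<BB> \<alpha>)" "\<alpha> \<cdot> \<beta> = \<iota> (cod2 \<BB> \<alpha>)"
  shows "inverse2 \<BB> \<alpha> \<beta>"
  using assms by (auto simp: inverse2_def in_hom2_def)

lemma inverse2_sym: "inverse2 \<BB> \<alpha> \<beta> \<Longrightarrow> inverse2 \<BB> \<beta> \<alpha>"
  by (auto simp: inverse2_def in_hom2_def)

lemma inv2_inv2 [simp]:
  assumes "iso2 \<BB> \<alpha>" shows "iso2 \<BB> (inv2 \<BB> \<alpha>)" "inv2 \<BB> (inv2 \<BB> \<alpha>) = \<alpha>"
  using inverse2_sym[OF inverse2_inv2[OF assms]] by (auto simp: iso2_def intro: inv2_eq)

lemma iso2_id [simp]:
  assumes "g \<in> Cell1 \<BB>" shows "iso2 \<BB> (\<iota> g)" "inv2 \<BB> (\<iota> g) = \<iota> g"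
proof -
  have "inverse2 \<BB> (\<iota> g) (\<iota> g)" using assms by (auto intro: inverse2I)
  then show "iso2 \<BB> (\<iota> g)" "inv2 \<BB> (\<iota> g) = \<iota> g" by (auto simp: iso2_def intro: inv2_eq)
qed

lemma iso2_vcomp:
  assumes "iso2 \<BB> \<alpha>" "iso2 \<BB> \<beta>" "cod2 \<BB> \<alpha> = dom2 \<BB> \<beta>"
  shows "iso2 \<BB> (\<beta> \<cdot> \<alpha>)" "inv2 \<BB> (\<beta> \<cdot> \<alpha>) = inv2 \<BB> \<alpha> \<cdot> inv2 \<BB> \<beta>"
proof -
  have "inverse2 \<BB> (\<beta> \<cdot> \<alpha>) (inv2 \<BB> \<alpha> \<cdot> inv2 \<BB> \<beta>)"
    using assms iso2_cell by (intro inverse2I) (auto simp: vcomp_reassoc)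
  then show "iso2 \<BB> (\<beta> \<cdot> \<alpha>)" "inv2 \<BB> (\<beta> \<cdot> \<alpha>) = inv2 \<BB> \<alpha> \<cdot> inv2 \<BB> \<beta>"
    by (auto simp: iso2_def intro: inv2_eq)
qed

lemma iso2_hcomp [simp]:
  assumes "iso2 \<BB> \<alpha>" "iso2 \<BB> \<beta>" "trg \<BB> (dom2 \<BB> \<alpha>) = src \<BB> (dom2 \<BB> \<beta>)"
  shows "iso2 \<BB> (\<beta> \<star> \<alpha>)" "inv2 \<BB> (\<beta> \<star> \<alpha>) = inv2 \<BB> \<beta> \<star> inv2 \<BB> \<alpha>"
proof -
  have "inverse2 \<BB> (\<beta> \<star> \<alpha>) (inv2 \<BB> \<beta> \<star> inv2 \<BB> \<alpha>)"
    using assms iso2_cell by (intro inverse2I) (auto simp: hcomp_vcomp)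
  then show "iso2 \<BB> (\<beta> \<star> \<alpha>)" "inv2 \<BB> (\<beta> \<star> \<alpha>) = inv2 \<BB> \<beta> \<star> inv2 \<BB> \<alpha>"
    by (auto simp: iso2_def intro: inv2_eq)
qed

lemma iso2_cancel_left:
  assumes "iso2 \<BB> \<alpha>" "\<alpha> \<cdot> \<sigma> = \<alpha> \<cdot> \<tau>" "\<sigma> \<in> Cell2 \<BB>" "\<tau> \<in> Cell2 \<BB>"
    "cod2 \<BB> \<sigma> = dom2 \<BB> \<alpha>" "cod2 \<BB> \<tau> = dom2 \<BB> \<alpha>"
  shows "\<sigma> = \<tau>"
  using assms inv2_cancel(1) by metis

lemma iso2_cancel_right:
  assumes "iso2 \<BB> \<alpha>" "\<sigma> \<cdot> \<alpha> = \<tau> \<cdot> \<alpha>" "\<sigma> \<in> Cell2 \<BB>" "\<tau> \<in> Cell2 \<BB>"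
    "dom2 \<BB> \<sigma> = cod2 \<BB> \<alpha>" "dom2 \<BB> \<tau> = cod2 \<BB> \<alpha>"
  shows "\<sigma> = \<tau>"
proof -
  have "(\<sigma> \<cdot> \<alpha>) \<cdot> inv2 \<BB> \<alpha> = (\<tau> \<cdot> \<alpha>) \<cdot> inv2 \<BB> \<alpha>" using assms by simp
  then show ?thesis using assms(1,3-) iso2_cell[OF assms(1)] by (simp add: vcomp_reassoc)
qed

lemma assoc_cell [simp]:
  assumes "f \<in> Cell1 \<BB>" "g \<in> Cell1 \<BB>" "h \<in> Cell1 \<BB>" "trg \<BB> f = src \<BB> g" "trg \<BB> g = src \<BB> h"
  shows "\<a> h g f \<in> Cell2 \<BB>" "dom2 \<BB> (\<a> h g f) = (h \<odot> g) \<odot> f" "cod2 \<BB> (\<a> h g f) = h \<odot> g \<odot> f"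
    "iso2 \<BB> (\<a> h g f)"
  using assoc_hom[of f "src \<BB> f" "trg \<BB> f" g "trg \<BB> g" h "trg \<BB> h"] assms
  by (auto simp: in_hom1_def in_hom2_def)

lemma lunit_runit_cell [simp]:
  assumes "f \<in> Cell1 \<BB>"
  shows "\<l> f \<in> Cell2 \<BB>" "dom2 \<BB> (\<l> f) = \<U> (trg \<BB> f) \<odot> f" "cod2 \<BB> (\<l> f) = f" "iso2 \<BB> (\<l> f)"
    "\<r> f \<in> Cell2 \<BB>" "dom2 \<BB> (\<r> f) = f \<odot> \<U> (src \<BB> f)" "cod2 \<BB> (\<r> f) = f" "iso2 \<BB> (\<r> f)"
  using lunit_hom[of f "src \<BB> f" "trg \<BB> f"] runit_hom[of f "src \<BB> f" "trg \<BB> f"] assms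
  by (auto simp: in_hom1_def in_hom2_def)

lemma assoc_nat:
  assumes "\<alpha> \<in> Cell2 \<BB>" "\<beta> \<in> Cell2 \<BB>" "\<gamma> \<in> Cell2 \<BB>" "cod2 \<BB> \<gamma> = h'" "cod2 \<BB> \<beta> = g'" "cod2 \<BB> \<alpha> = f'"
    "trg \<BB> (dom2 \<BB> \<alpha>) = src \<BB> (dom2 \<BB> \<beta>)" "trg \<BB> (dom2 \<BB> \<beta>) = src \<BB> (dom2 \<BB> \<gamma>)"
  shows "\<a> h' g' f' \<cdot> ((\<gamma> \<star> \<beta>) \<star> \<alpha>)
    = (\<gamma> \<star> \<beta> \<star> \<alpha>) \<cdot> \<a> (dom2 \<BB> \<gamma>) (dom2 \<BB> \<beta>) (dom2 \<BB> \<alpha>)"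
  using assoc_natural[of \<alpha> "dom2 \<BB> \<alpha>" f' \<beta> "dom2 \<BB> \<beta>" g' \<gamma> "dom2 \<BB> \<gamma>" h'] assms
  by (auto simp: in_hom2_def)

lemma assoc_nat_right:
  assumes "\<alpha> \<in> Cell2 \<BB>" "g \<in> Cell1 \<BB>" "h \<in> Cell1 \<BB>" "cod2 \<BB> \<alpha> = f'"
    "trg \<BB> (dom2 \<BB> \<alpha>) = src \<BB> g" "trg \<BB> g = src \<BB> h"
  shows "\<a> h g f' \<cdot> (\<iota> (h \<odot> g) \<star> \<alpha>) = (\<iota> h \<star> \<iota> g \<star> \<alpha>) \<cdot> \<a> h g (dom2 \<BB> \<alpha>)"
  using assoc_nat[of \<alpha> "\<iota> g" "\<iota> h" h g f'] assms by simp

lemma assoc_nat_left: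
  assumes "\<gamma> \<in> Cell2 \<BB>" "g \<in> Cell1 \<BB>" "f \<in> Cell1 \<BB>" "cod2 \<BB> \<gamma> = h'"
    "trg \<BB> f = src \<BB> g" "trg \<BB> g = src \<BB> (dom2 \<BB> \<gamma>)"
  shows "\<a> h' g f \<cdot> ((\<gamma> \<star> \<iota> g) \<star> \<iota> f) = (\<gamma> \<star> \<iota> (g \<odot> f)) \<cdot> \<a> (dom2 \<BB> \<gamma>) g f"
  using assoc_nat[of "\<iota> f" "\<iota> g" \<gamma> h' g f] assms by simp

lemma lunit_nat:
  assumes "\<alpha> \<in> Cell2 \<BB>" "cod2 \<BB> \<alpha> = g" "trg \<BB> (dom2 \<BB> \<alpha>) = X"
  shows "\<l> g \<cdot> (\<iota> (\<U> X) \<star> \<alpha>) = \<alpha> \<cdot> \<l> (dom2 \<BB> \<alpha>)"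
  using lunit_natural[of \<alpha> "dom2 \<BB> \<alpha>" g] assms by (auto simp: in_hom2_def)

lemma runit_nat:
  assumes "\<alpha> \<in> Cell2 \<BB>" "cod2 \<BB> \<alpha> = g" "src \<BB> (dom2 \<BB> \<alpha>) = X"
  shows "\<r> g \<cdot> (\<alpha> \<star> \<iota> (\<U> X)) = \<alpha> \<cdot> \<r> (dom2 \<BB> \<alpha>)"
  using runit_natural[of \<alpha> "dom2 \<BB> \<alpha>" g] assms by (auto simp: in_hom2_def)

lemma pentagon':
  assumes "f \<in> Cell1 \<BB>" "g \<in> Cell1 \<BB>" "h \<in> Cell1 \<BB>" "k \<in> Cell1 \<BB>"
    "trg \<BB> f = src \<BB> g" "trg \<BB> g = src \<BB> h" "trg \<BB> h = src \<BB> k"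
  shows "(\<iota> k \<star> \<a> h g f) \<cdot> \<a> k (h \<odot> g) f \<cdot> (\<a> k h g \<star> \<iota> f) = \<a> k h (g \<odot> f) \<cdot> \<a> (k \<odot> h) g f"
  using pentagon[of f "src \<BB> f" "trg \<BB> f" g "trg \<BB> g" h "trg \<BB> h" k "trg \<BB> k"] assms
  by (auto simp: in_hom1_def)

lemma triangle':
  assumes "f \<in> Cell1 \<BB>" "g \<in> Cell1 \<BB>" "trg \<BB> f = Y" "src \<BB> g = Y"
  shows "(\<iota> g \<star> \<l> f) \<cdot> \<a> g (\<U> Y) f = \<r> g \<star> \<iota> f"
  using triangle[of f "src \<BB> f" Y g "trg \<BB> g"] assms by (auto simp: in_hom1_def)

section \<open>Unit coherence and reversal of 1-cells\<close>

text \<open>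
Whiskering with an identity 1-cell is naturally isomorphic to the identity functor.
\<close>
lemma lunit_whisker_faithful:
  assumes "\<sigma> \<in> Cell2 \<BB>" "\<tau> \<in> Cell2 \<BB>" "dom2 \<BB> \<sigma> = dom2 \<BB> \<tau>" "cod2 \<BB> \<sigma> = cod2 \<BB> \<tau>"
    "trg \<BB> (dom2 \<BB> \<tau>) = X" "\<iota> (\<U> X) \<star> \<sigma> = \<iota> (\<U> X) \<star> \<tau>"
  shows "\<sigma> = \<tau>"
proof -
  have "\<sigma> \<cdot> \<l> (dom2 \<BB> \<tau>) = \<tau> \<cdot> \<l> (dom2 \<BB> \<tau>)"
    using lunit_nat[of \<sigma> "cod2 \<BB> \<tau>" X] lunit_nat[of \<tau> "cod2 \<BB> \<tau>" X] assms by simp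
  then show ?thesis by (rule iso2_cancel_right[rotated]) (use assms in auto)
qed

text \<open>
Kelly's unit coherence.  After whiskering with the identity 1-cell, both sides can be compared
inside a pentagon, where the triangle axiom applies twice.
\<close>
lemma lunit_comp:
  assumes "f \<in> Cell1 \<BB>" "g \<in> Cell1 \<BB>" "trg \<BB> f = src \<BB> g" "trg \<BB> g = Z"
  shows "\<l> (g \<odot> f) \<cdot> \<a> (\<U> Z) g f = \<l> g \<star> \<iota> f"
proof (rule lunit_whisker_faithful[where X = Z])
  have Z [simp]: "Z \<in> Cell0 \<BB>" using assms by auto
  note [simp] = assms
  let ?U = "\<U> Z"
  let ?p = "\<a> ?U (?U \<odot> g) f \<cdot> (\<a> ?U ?U g \<star> \<iota> f)"
  have "(\<iota> ?U \<star> (\<l> (g \<odot> f) \<cdot> \<a> ?U g f)) \<cdot> ?p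
    = (\<iota> ?U \<star> \<l> (g \<odot> f)) \<cdot> (\<iota> ?U \<star> \<a> ?U g f) \<cdot> \<a> ?U (?U \<odot> g) f \<cdot> (\<a> ?U ?U g \<star> \<iota> f)"
    by (simp add: whisker_left vcomp_reassoc)
  also have "\<dots> = (\<iota> ?U \<star> \<l> (g \<odot> f)) \<cdot> \<a> ?U ?U (g \<odot> f) \<cdot> \<a> (?U \<odot> ?U) g f"
    by (simp add: pentagon')
  also have "\<dots> = (\<r> ?U \<star> \<iota> (g \<odot> f)) \<cdot> \<a> (?U \<odot> ?U) g f"
    by (simp add: triangle'[THEN prolong])
  also have "\<dots> = \<a> ?U g f \<cdot> (((\<iota> ?U \<star> \<l> g) \<cdot> \<a> ?U ?U g) \<star> \<iota> f)"
    by (simp add: assoc_nat_left triangle')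
  also have "\<dots> = (\<iota> ?U \<star> \<l> g \<star> \<iota> f) \<cdot> ?p"
    by (simp add: whisker_right assoc_nat assoc_nat[THEN prolong] vcomp_reassoc)
  finally show "\<iota> ?U \<star> (\<l> (g \<odot> f) \<cdot> \<a> ?U g f) = \<iota> ?U \<star> \<l> g \<star> \<iota> f"
    by (rule iso2_cancel_right[rotated]) (auto intro: iso2_vcomp)
qed (use assms in auto)

text \<open>
Conjugating a naturality square by inverses; used to obtain naturality of inverse constraints.
\<close>
lemma inv2_move:
  assumes "iso2 \<BB> \<alpha>" "iso2 \<BB> \<beta>" "\<alpha> \<cdot> \<sigma> = \<tau> \<cdot> \<beta>" "\<sigma> \<in> Cell2 \<BB>" "\<tau> \<in> Cell2 \<BB>"
    "cod2 \<BB> \<sigma> = dom2 \<BB> \<alpha>" "dom2 \<BB> \<tau> = cod2 \<BB> \<beta>"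
    "dom2 \<BB> \<sigma> = dom2 \<BB> \<beta>" "cod2 \<BB> \<tau> = cod2 \<BB> \<alpha>"
  shows "\<sigma> \<cdot> inv2 \<BB> \<beta> = inv2 \<BB> \<alpha> \<cdot> \<tau>"
proof (rule iso2_cancel_left[OF assms(1)])
  have "\<alpha> \<cdot> \<sigma> \<cdot> inv2 \<BB> \<beta> = (\<tau> \<cdot> \<beta>) \<cdot> inv2 \<BB> \<beta>"
    using assms iso2_cell by (simp flip: vcomp_reassoc)
  then show "\<alpha> \<cdot> \<sigma> \<cdot> inv2 \<BB> \<beta> = \<alpha> \<cdot> inv2 \<BB> \<alpha> \<cdot> \<tau>"
    using assms iso2_cell[OF assms(1)] iso2_cell[OF assms(2)] by (simp add: vcomp_reassoc)
  show "cod2 \<BB> (inv2 \<BB> \<alpha> \<cdot> \<tau>) = dom2 \<BB> \<alpha>" "inv2 \<BB> \<alpha> \<cdot> \<tau> \<in> Cell2 \<BB>" using assms by simp_all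
qed (use assms in auto)

lemma assoc_inv_nat:
  assumes "\<alpha> \<in> Cell2 \<BB>" "\<beta> \<in> Cell2 \<BB>" "\<gamma> \<in> Cell2 \<BB>" "cod2 \<BB> \<gamma> = h'" "cod2 \<BB> \<beta> = g'" "cod2 \<BB> \<alpha> = f'"
    "trg \<BB> (dom2 \<BB> \<alpha>) = src \<BB> (dom2 \<BB> \<beta>)" "trg \<BB> (dom2 \<BB> \<beta>) = src \<BB> (dom2 \<BB> \<gamma>)"
  shows "inv2 \<BB> (\<a> h' g' f') \<cdot> (\<gamma> \<star> \<beta> \<star> \<alpha>)
    = ((\<gamma> \<star> \<beta>) \<star> \<alpha>) \<cdot> inv2 \<BB> (\<a> (dom2 \<BB> \<gamma>) (dom2 \<BB> \<beta>) (dom2 \<BB> \<alpha>))"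
  by (rule sym, rule inv2_move[OF _ _ assoc_nat]) (use assms in auto)

lemma pentagon_inv:
  assumes "f \<in> Cell1 \<BB>" "g \<in> Cell1 \<BB>" "h \<in> Cell1 \<BB>" "k \<in> Cell1 \<BB>"
    "trg \<BB> f = src \<BB> g" "trg \<BB> g = src \<BB> h" "trg \<BB> h = src \<BB> k"
  shows "(inv2 \<BB> (\<a> k h g) \<star> \<iota> f) \<cdot> inv2 \<BB> (\<a> k (h \<odot> g) f) \<cdot> (\<iota> k \<star> inv2 \<BB> (\<a> h g f))
    = inv2 \<BB> (\<a> (k \<odot> h) g f) \<cdot> inv2 \<BB> (\<a> k h (g \<odot> f))"
proof -
  have "inv2 \<BB> ((\<iota> k \<star> \<a> h g f) \<cdot> \<a> k (h \<odot> g) f \<cdot> (\<a> k h g \<star> \<iota> f))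
      = inv2 \<BB> (\<a> k h (g \<odot> f) \<cdot> \<a> (k \<odot> h) g f)"
    using assms by (simp add: pentagon')
  then show ?thesis using assms by (simp add: iso2_vcomp vcomp_reassoc)
qed

lemma triangle_inv:
  assumes "f \<in> Cell1 \<BB>" "g \<in> Cell1 \<BB>" "trg \<BB> f = Y" "src \<BB> g = Y"
  shows "(\<r> g \<star> \<iota> f) \<cdot> inv2 \<BB> (\<a> g (\<U> Y) f) = \<iota> g \<star> \<l> f"
proof -
  have "Y \<in> Cell0 \<BB>" using assms by auto
  then show ?thesis using assms by (simp add: vcomp_reassoc flip: triangle')
qed

end

text \<open>
The associativity constraint changes direction when 1-cells are reversed, hence its inverse;
vertical composition is untouched, so that all notions about a single hom-category are shared.
\<close>
definition op_bicat :: "('o, 'm, 'c, 'z) bicat_scheme \<Rightarrow> ('o, 'm, 'c) bicat" where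
  "op_bicat \<BB> = \<lparr>Cell0 = Cell0 \<BB>, Cell1 = Cell1 \<BB>, Cell2 = Cell2 \<BB>, src = trg \<BB>, trg = src \<BB>,
     dom2 = dom2 \<BB>, cod2 = cod2 \<BB>, id1 = id1 \<BB>, id2 = id2 \<BB>,
     comp1 = (\<lambda>g f. f \<odot>\<^bsub>\<BB>\<^esub> g), hcomp = (\<lambda>\<beta> \<alpha>. \<alpha> \<star>\<^bsub>\<BB>\<^esub> \<beta>), vcomp = vcomp \<BB>,
     assoc = (\<lambda>h g f. inv2 \<BB> (\<a>\<^bsub>\<BB>\<^esub> f g h)), lunit = runit \<BB>, runit = lunit \<BB>\<rparr>"

lemma op_bicat_fields [simp]:
  "Cell0 (op_bicat \<BB>) = Cell0 \<BB>" "Cell1 (op_bicat \<BB>) = Cell1 \<BB>" "Cell2 (op_bicat \<BB>) = Cell2 \<BB>"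
  "src (op_bicat \<BB>) = trg \<BB>" "trg (op_bicat \<BB>) = src \<BB>" "dom2 (op_bicat \<BB>) = dom2 \<BB>" "cod2 (op_bicat \<BB>) = cod2 \<BB>"
  "id1 (op_bicat \<BB>) = id1 \<BB>" "id2 (op_bicat \<BB>) = id2 \<BB>" "g \<odot>\<^bsub>op_bicat \<BB>\<^esub> f = f \<odot>\<^bsub>\<BB>\<^esub> g"
  "\<beta> \<star>\<^bsub>op_bicat \<BB>\<^esub> \<alpha> = \<alpha> \<star>\<^bsub>\<BB>\<^esub> \<beta>" "vcomp (op_bicat \<BB>) = vcomp \<BB>" "\<a>\<^bsub>op_bicat \<BB>\<^esub> h g f = inv2 \<BB> (\<a>\<^bsub>\<BB>\<^esub> f g h)"
  "lunit (op_bicat \<BB>) = runit \<BB>" "runit (op_bicat \<BB>) = lunit \<BB>"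
  by (simp_all add: op_bicat_def)

lemma op_bicat_notions [simp]:
  "in_hom1 (op_bicat \<BB>) g X Y = in_hom1 \<BB> g Y X" "in_hom2 (op_bicat \<BB>) = in_hom2 \<BB>"
  "inverse2 (op_bicat \<BB>) = inverse2 \<BB>" "iso2 (op_bicat \<BB>) = iso2 \<BB>" "inv2 (op_bicat \<BB>) = inv2 \<BB>"
  "mono2 (op_bicat \<BB>) = mono2 \<BB>" "is_equalizer (op_bicat \<BB>) = is_equalizer \<BB>"
  "regular_mono (op_bicat \<BB>) = regular_mono \<BB>"
  "sub_equiv (op_bicat \<BB>) = sub_equiv \<BB>" "subobject (op_bicat \<BB>) = subobject \<BB>"
  by (auto simp: in_hom1_def in_hom2_def inverse2_def iso2_def inv2_def mono2_def is_equalizer_def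
      regular_mono_def sub_equiv_def subobject_def fun_eq_iff)

context bicategory
begin

lemma bicategory_op_bicat: "bicategory (op_bicat \<BB>)"

  by (unfold_locales, simp_all only: op_bicat_fields op_bicat_notions)
    (auto simp: in_hom1_def in_hom2_def vcomp_reassoc hcomp_vcomp lunit_nat runit_nat
      assoc_inv_nat pentagon_inv triangle_inv)

lemma whisker_inv_cancel [simp]:
  assumes "iso2 \<BB> \<alpha>" "g \<in> Cell1 \<BB>" 
  shows "trg \<BB> g = src \<BB> (dom2 \<BB> \<alpha>) \<Longrightarrow> (\<alpha> \<star> \<iota> g) \<cdot> (inv2 \<BB> \<alpha> \<star> \<iota> g) = \<iota> (cod2 \<BB> \<alpha> \<odot> g)"
    "trg \<BB> g = src \<BB> (dom2 \<BB> \<alpha>) \<Longrightarrow> (inv2 \<BB> \<alpha> \<star> \<iota> g) \<cdot> (\<alpha> \<star> \<iota> g) = \<iota> (dom2 \<BB> \<alpha> \<odot> g)"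
    "src \<BB> g = trg \<BB> (dom2 \<BB> \<alpha>) \<Longrightarrow> (\<iota> g \<star> \<alpha>) \<cdot> (\<iota> g \<star> inv2 \<BB> \<alpha>) = \<iota> (g \<odot> cod2 \<BB> \<alpha>)"
    "src \<BB> g = trg \<BB> (dom2 \<BB> \<alpha>) \<Longrightarrow> (\<iota> g \<star> inv2 \<BB> \<alpha>) \<cdot> (\<iota> g \<star> \<alpha>) = \<iota> (g \<odot> dom2 \<BB> \<alpha>)"
  using assms iso2_cell[OF assms(1)] by (simp_all add: hcomp_vcomp)

lemma whisker_inv_cancel_prolonged [simp]:
  assumes "iso2 \<BB> \<alpha>" "g \<in> Cell1 \<BB>" "\<tau> \<in> Cell2 \<BB>"
  shows "trg \<BB> g = src \<BB> (dom2 \<BB> \<alpha>) \<Longrightarrow> cod2 \<BB> \<tau> = cod2 \<BB> \<alpha> \<odot> g \<Longrightarrow>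
      (\<alpha> \<star> \<iota> g) \<cdot> (inv2 \<BB> \<alpha> \<star> \<iota> g) \<cdot> \<tau> = \<tau>"
    "trg \<BB> g = src \<BB> (dom2 \<BB> \<alpha>) \<Longrightarrow> cod2 \<BB> \<tau> = dom2 \<BB> \<alpha> \<odot> g \<Longrightarrow>
      (inv2 \<BB> \<alpha> \<star> \<iota> g) \<cdot> (\<alpha> \<star> \<iota> g) \<cdot> \<tau> = \<tau>"
    "src \<BB> g = trg \<BB> (dom2 \<BB> \<alpha>) \<Longrightarrow> cod2 \<BB> \<tau> = g \<odot> cod2 \<BB> \<alpha> \<Longrightarrow>
      (\<iota> g \<star> \<alpha>) \<cdot> (\<iota> g \<star> inv2 \<BB> \<alpha>) \<cdot> \<tau> = \<tau>"
    "src \<BB> g = trg \<BB> (dom2 \<BB> \<alpha>) \<Longrightarrow> cod2 \<BB> \<tau> = g \<odot> dom2 \<BB> \<alpha> \<Longrightarrow>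
      (\<iota> g \<star> inv2 \<BB> \<alpha>) \<cdot> (\<iota> g \<star> \<alpha>) \<cdot> \<tau> = \<tau>"
  using assms iso2_cell[OF assms(1)] by (simp_all add: whisker_inv_cancel[THEN prolong])

lemma triangle_move:
  assumes "f \<in> Cell1 \<BB>" "g \<in> Cell1 \<BB>" "trg \<BB> f = Y" "src \<BB> g = Y"
  shows "\<a> g (\<U> Y) f \<cdot> (inv2 \<BB> (\<r> g) \<star> \<iota> f) = \<iota> g \<star> inv2 \<BB> (\<l> f)"
proof -
  have "Y \<in> Cell0 \<BB>" using assms by auto
  then have "inv2 \<BB> ((\<r> g \<star> \<iota> f) \<cdot> inv2 \<BB> (\<a> g (\<U> Y) f)) = inv2 \<BB> (\<iota> g \<star> \<l> f)"
    using assms by (simp add: triangle_inv)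
  then show ?thesis using assms \<open>Y \<in> Cell0 \<BB>\<close> by (simp add: iso2_vcomp)
qed

lemma inv_lunit_comp:
  assumes "f \<in> Cell1 \<BB>" "g \<in> Cell1 \<BB>" "trg \<BB> f = src \<BB> g" "trg \<BB> g = Z"
  shows "inv2 \<BB> (\<l> (g \<odot> f)) = \<a> (\<U> Z) g f \<cdot> (inv2 \<BB> (\<l> g) \<star> \<iota> f)"
proof -
  have "Z \<in> Cell0 \<BB>" using assms by auto
  then have "inv2 \<BB> (\<l> (g \<odot> f) \<cdot> \<a> (\<U> Z) g f) = inv2 \<BB> (\<l> g \<star> \<iota> f)"
    using assms by (simp add: lunit_comp)
  with \<open>Z \<in> Cell0 \<BB>\<close> have "\<a> (\<U> Z) g f \<cdot> inv2 \<BB> (\<a> (\<U> Z) g f) \<cdot> inv2 \<BB> (\<l> (g \<odot> f))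
      = \<a> (\<U> Z) g f \<cdot> (inv2 \<BB> (\<l> g) \<star> \<iota> f)"
    using assms by (simp add: iso2_vcomp del: inv2_cancel)
  then show ?thesis using assms \<open>Z \<in> Cell0 \<BB>\<close> by simp
qed

text \<open>
Forms of the pentagon with some of its edges inverted, for calculations that meet a path through
the pentagon starting at another corner.
\<close>
lemma pentagon_mixed:
  assumes "f \<in> Cell1 \<BB>" "g \<in> Cell1 \<BB>" "h \<in> Cell1 \<BB>" "k \<in> Cell1 \<BB>"
    "trg \<BB> f = src \<BB> g" "trg \<BB> g = src \<BB> h" "trg \<BB> h = src \<BB> k"
  shows "inv2 \<BB> (\<a> k h (g \<odot> f)) \<cdot> (\<iota> k \<star> \<a> h g f) \<cdot> \<a> k (h \<odot> g) f
    = \<a> (k \<odot> h) g f \<cdot> (inv2 \<BB> (\<a> k h g) \<star> \<iota> f)"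
proof (rule iso2_cancel_right[where \<alpha> = "\<a> k h g \<star> \<iota> f"])
  show "(inv2 \<BB> (\<a> k h (g \<odot> f)) \<cdot> (\<iota> k \<star> \<a> h g f) \<cdot> \<a> k (h \<odot> g) f) \<cdot> (\<a> k h g \<star> \<iota> f)
    = (\<a> (k \<odot> h) g f \<cdot> (inv2 \<BB> (\<a> k h g) \<star> \<iota> f)) \<cdot> (\<a> k h g \<star> \<iota> f)"
    using assms by (simp add: vcomp_reassoc pentagon')
qed (use assms in auto)

lemma inv_runit_comp:
  assumes "f \<in> Cell1 \<BB>" "g \<in> Cell1 \<BB>" "trg \<BB> f = src \<BB> g" "src \<BB> f = X"
  shows "inv2 \<BB> (\<r> (g \<odot> f)) = inv2 \<BB> (\<a> g f (\<U> X)) \<cdot> (\<iota> g \<star> inv2 \<BB> (\<r> f))"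
  using bicategory.inv_lunit_comp[OF bicategory_op_bicat, of g f X] assms by simp

lemma pentagon_mixed':
  assumes "f \<in> Cell1 \<BB>" "g \<in> Cell1 \<BB>" "h \<in> Cell1 \<BB>" "k \<in> Cell1 \<BB>"
    "trg \<BB> f = src \<BB> g" "trg \<BB> g = src \<BB> h" "trg \<BB> h = src \<BB> k"
  shows "\<a> k (h \<odot> g) f \<cdot> (\<a> k h g \<star> \<iota> f) \<cdot> inv2 \<BB> (\<a> (k \<odot> h) g f)
    = (\<iota> k \<star> inv2 \<BB> (\<a> h g f)) \<cdot> \<a> k h (g \<odot> f)"
proof (rule iso2_cancel_right[where \<alpha> = "\<a> (k \<odot> h) g f"])
  show "(\<a> k (h \<odot> g) f \<cdot> (\<a> k h g \<star> \<iota> f) \<cdot> inv2 \<BB> (\<a> (k \<odot> h) g f)) \<cdot> \<a> (k \<odot> h) g f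
    = ((\<iota> k \<star> inv2 \<BB> (\<a> h g f)) \<cdot> \<a> k h (g \<odot> f)) \<cdot> \<a> (k \<odot> h) g f"
    using assms by (simp add: vcomp_reassoc flip: pentagon')
qed (use assms in auto)

lemma prolong3:
  assumes "\<gamma> \<cdot> \<beta> \<cdot> \<alpha> = \<delta>" "\<tau> \<in> Cell2 \<BB>" "\<alpha> \<in> Cell2 \<BB>" "\<beta> \<in> Cell2 \<BB>" "\<gamma> \<in> Cell2 \<BB>"
    "cod2 \<BB> \<tau> = dom2 \<BB> \<alpha>" "cod2 \<BB> \<alpha> = dom2 \<BB> \<beta>" "cod2 \<BB> \<beta> = dom2 \<BB> \<gamma>"
  shows "\<gamma> \<cdot> \<beta> \<cdot> \<alpha> \<cdot> \<tau> = \<delta> \<cdot> \<tau>"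
  using assms(2-) by (simp add: vcomp_reassoc flip: assms(1))
end

section \<open>Whiskering along an adjunction\<close>

locale bicategory_adjunction = bicategory \<BB>
  for \<BB> :: "('o, 'm, 'c, 'z) bicat_scheme" (structure) +
  fixes A B :: 'o and f fs :: 'm and \<eta> \<epsilon> :: 'c
  assumes adj: "adjunction \<BB> A B f fs \<eta> \<epsilon>"
begin

lemma adj_cell [simp]:
  "f \<in> Cell1 \<BB>" "src \<BB> f = A" "trg \<BB> f = B" "fs \<in> Cell1 \<BB>" "src \<BB> fs = B" "trg \<BB> fs = A"
  "\<eta> \<in> Cell2 \<BB>" "dom2 \<BB> \<eta> = \<U> A" "cod2 \<BB> \<eta> = fs \<odot> f"
  "\<epsilon> \<in> Cell2 \<BB>" "dom2 \<BB> \<epsilon> = f \<odot> fs" "cod2 \<BB> \<epsilon> = \<U> B" "A \<in> Cell0 \<BB>" "B \<in> Cell0 \<BB>"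
  using adj src_trg by (auto simp: adjunction_def in_hom1_def in_hom2_def)

lemma adjunction_op_bicat: "bicategory_adjunction (op_bicat \<BB>) A B fs f \<eta> \<epsilon>"
  using adj bicategory_op_bicat
  by (simp add: adjunction_def bicategory_adjunction_def bicategory_adjunction_axioms_def)

text \<open>
The adjunction \<open>f \<stileturn> f\<^sup>*\<close> acts by whiskering on both sides.  \<open>unit\<close> and \<open>counit\<close> belong to
\<open>f \<otimes> - \<stileturn> f\<^sup>* \<otimes> -\<close>; the primed versions belong to \<open>- \<otimes> f\<^sup>* \<stileturn> - \<otimes> f\<close> and are the
unprimed ones of the reversed bicategory.
\<close>
definition unit :: "'m \<Rightarrow> 'c" where
  "unit h = \<a> fs f h \<cdot> (\<eta> \<star> \<iota> h) \<cdot> inv2 \<BB> (\<l> h)"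

definition counit :: "'m \<Rightarrow> 'c" where
  "counit y = \<l> y \<cdot> (\<epsilon> \<star> \<iota> y) \<cdot> inv2 \<BB> (\<a> f fs y)"

definition unit' :: "'m \<Rightarrow> 'c" where
  "unit' x = inv2 \<BB> (\<a> x fs f) \<cdot> (\<iota> x \<star> \<eta>) \<cdot> inv2 \<BB> (\<r> x)"

definition counit' :: "'m \<Rightarrow> 'c" where
  "counit' y = \<r> y \<cdot> (\<iota> y \<star> \<epsilon>) \<cdot> \<a> y f fs"

lemma unit_cell' [simp]:
  assumes "h \<in> Cell1 \<BB>" "trg \<BB> h = A"
  shows "unit h \<in> Cell2 \<BB>" "dom2 \<BB> (unit h) = h" "cod2 \<BB> (unit h) = fs \<odot> f \<odot> h"
  using assms by (simp_all add: unit_def)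

lemma counit_cell' [simp]:
  assumes "y \<in> Cell1 \<BB>" "trg \<BB> y = B"
  shows "counit y \<in> Cell2 \<BB>" "dom2 \<BB> (counit y) = f \<odot> fs \<odot> y" "cod2 \<BB> (counit y) = y"
  using assms by (simp_all add: counit_def)

lemma unit'_cell [simp]:
  assumes "x \<in> Cell1 \<BB>" "src \<BB> x = A"
  shows "unit' x \<in> Cell2 \<BB>" "dom2 \<BB> (unit' x) = x" "cod2 \<BB> (unit' x) = (x \<odot> fs) \<odot> f"
  using assms by (simp_all add: unit'_def)

lemma counit'_cell [simp]:
  assumes "y \<in> Cell1 \<BB>" "src \<BB> y = B"
  shows "counit' y \<in> Cell2 \<BB>" "dom2 \<BB> (counit' y) = (y \<odot> f) \<odot> fs" "cod2 \<BB> (counit' y) = y"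
  using assms by (simp_all add: counit'_def)

lemma zigzag:
  "counit f \<cdot> (\<iota> f \<star> \<eta>) \<cdot> inv2 \<BB> (\<r> f) = \<iota> f"
  "\<l> f \<cdot> (\<epsilon> \<star> \<iota> f) \<cdot> unit' f = \<iota> f"
  "counit' fs \<cdot> (\<eta> \<star> \<iota> fs) \<cdot> inv2 \<BB> (\<l> fs) = \<iota> fs"
  using adj by (simp_all add: adjunction_def counit_def counit'_def unit'_def vcomp_reassoc)

lemma unit_nat:
  assumes "\<alpha> \<in> Cell2 \<BB>" "cod2 \<BB> \<alpha> = h'" "trg \<BB> (dom2 \<BB> \<alpha>) = A"
  shows "unit h' \<cdot> \<alpha> = (\<iota> fs \<star> \<iota> f \<star> \<alpha>) \<cdot> unit (dom2 \<BB> \<alpha>)"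
proof -
  note [simp] = assms(1,3) assms(2)[symmetric]
  have *: "inv2 \<BB> (\<l> h') \<cdot> \<alpha> = (\<iota> (\<U> A) \<star> \<alpha>) \<cdot> inv2 \<BB> (\<l> (dom2 \<BB> \<alpha>))"
    by (rule sym, rule inv2_move) (auto simp: lunit_nat)
  show ?thesis
    using * unfolding unit_def
    by (simp add: vcomp_reassoc whisker_exchange[THEN prolong]
        assoc_nat_right[THEN prolong])
qed

lemma counit_nat:
  assumes "\<alpha> \<in> Cell2 \<BB>" "cod2 \<BB> \<alpha> = y'" "trg \<BB> (dom2 \<BB> \<alpha>) = B"
  shows "counit y' \<cdot> (\<iota> f \<star> \<iota> fs \<star> \<alpha>) = \<alpha> \<cdot> counit (dom2 \<BB> \<alpha>)"
proof -
  note [simp] = assms(1,3) assms(2)[symmetric]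
  have "counit y' \<cdot> (\<iota> f \<star> \<iota> fs \<star> \<alpha>)
    = \<l> y' \<cdot> (\<epsilon> \<star> \<iota> y') \<cdot> (\<iota> (f \<odot> fs) \<star> \<alpha>) \<cdot> inv2 \<BB> (\<a> f fs (dom2 \<BB> \<alpha>))"
    by (simp add: counit_def vcomp_reassoc assoc_inv_nat)
  also have "\<dots> = \<alpha> \<cdot> counit (dom2 \<BB> \<alpha>)"
    by (simp add: counit_def vcomp_reassoc whisker_exchange[THEN prolong] lunit_nat[THEN prolong])
  finally show ?thesis .
qed

lemma op_bicat_unit: "bicategory_adjunction.unit (op_bicat \<BB>) fs f \<eta> = unit'"
  by (simp add: bicategory_adjunction.unit_def[OF adjunction_op_bicat] unit'_def fun_eq_iff)

lemma op_bicat_unit': "h \<in> Cell1 \<BB> \<Longrightarrow> trg \<BB> h = A \<Longrightarrow> bicategory_adjunction.unit' (op_bicat \<BB>) fs f \<eta> h = unit h"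
  by (simp add: bicategory_adjunction.unit'_def[OF adjunction_op_bicat] unit_def)

lemma op_bicat_counit: "y \<in> Cell1 \<BB> \<Longrightarrow> src \<BB> y = B \<Longrightarrow> bicategory_adjunction.counit (op_bicat \<BB>) fs f \<epsilon> y = counit' y"
  by (simp add: bicategory_adjunction.counit_def[OF adjunction_op_bicat] counit'_def)

lemma unit'_nat:
  assumes "\<alpha> \<in> Cell2 \<BB>" "cod2 \<BB> \<alpha> = h'" "src \<BB> (dom2 \<BB> \<alpha>) = A"
  shows "unit' h' \<cdot> \<alpha> = ((\<alpha> \<star> \<iota> fs) \<star> \<iota> f) \<cdot> unit' (dom2 \<BB> \<alpha>)"
  using bicategory_adjunction.unit_nat[OF adjunction_op_bicat, of \<alpha> h'] assms by (simp add: op_bicat_unit)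

lemma counit'_nat:
  assumes "\<alpha> \<in> Cell2 \<BB>" "cod2 \<BB> \<alpha> = y'" "src \<BB> (dom2 \<BB> \<alpha>) = B"
  shows "counit' y' \<cdot> ((\<alpha> \<star> \<iota> f) \<star> \<iota> fs) = \<alpha> \<cdot> counit' (dom2 \<BB> \<alpha>)"
proof -
  have "y' \<in> Cell1 \<BB>" "src \<BB> y' = B" using assms by auto
  then show ?thesis
    using bicategory_adjunction.counit_nat[OF adjunction_op_bicat, of \<alpha> y'] assms by (simp add: op_bicat_counit)
qed

text \<open>
Inserting \<open>\<eta>\<close> between \<open>f\<close> and \<open>h\<close> can be read as an operation on \<open>f\<close> or as one on \<open>h\<close>.  This
links the two adjunctions, and for \<open>h = f\<^sup>*\<close> it yields the two forms of the comultiplication.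
\<close>
lemma whisker_unit:
  assumes [simp]: "h \<in> Cell1 \<BB>" "trg \<BB> h = A"
  shows "\<a> f fs (f \<odot> h) \<cdot> \<a> (f \<odot> fs) f h \<cdot> (unit' f \<star> \<iota> h) = \<iota> f \<star> unit h"
  unfolding unit'_def unit_def
  by (simp add: whisker_left whisker_right vcomp_reassoc pentagon'[symmetric, THEN prolong]
      assoc_nat[THEN prolong] triangle_move)

text \<open>
By naturality this is the triangle identity of \<open>f\<close> whiskered with \<open>h\<close>.
\<close>
lemma triangle_left:
  assumes [simp]: "h \<in> Cell1 \<BB>" "trg \<BB> h = A"
  shows "counit (f \<odot> h) \<cdot> (\<iota> f \<star> unit h) = \<iota> (f \<odot> h)"
proof -
  have "counit (f \<odot> h) \<cdot> (\<iota> f \<star> unit h)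
      = \<l> (f \<odot> h) \<cdot> (\<epsilon> \<star> \<iota> (f \<odot> h)) \<cdot> \<a> (f \<odot> fs) f h \<cdot> (unit' f \<star> \<iota> h)"
    by (simp add: counit_def vcomp_reassoc flip: whisker_unit)
  also have "\<dots> = (\<l> (f \<odot> h) \<cdot> \<a> (\<U> B) f h) \<cdot> ((\<epsilon> \<star> \<iota> f) \<star> \<iota> h) \<cdot> (unit' f \<star> \<iota> h)"
    by (simp add: assoc_nat_left assoc_nat_left[THEN prolong] vcomp_reassoc)
  also have "\<dots> = (\<l> f \<cdot> (\<epsilon> \<star> \<iota> f) \<cdot> unit' f) \<star> \<iota> h"
    by (simp add: lunit_comp whisker_right)
  also have "\<dots> = \<iota> (f \<odot> h)" by (simp add: zigzag)
  finally show ?thesis .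
qed

text \<open>
The analogue of \<open>whisker_unit\<close> for \<open>\<epsilon>\<close>; for \<open>y = f\<close> it yields the two forms of the multiplication
of \<open>S\<^sub>f\<close>.
\<close>
lemma whisker_counit:
  assumes [simp]: "y \<in> Cell1 \<BB>" "trg \<BB> y = B"
  shows "(\<iota> fs \<star> counit y) \<cdot> \<a> fs f (fs \<odot> y) \<cdot> \<a> (fs \<odot> f) fs y = counit' fs \<star> \<iota> y"
  unfolding counit_def counit'_def
  by (simp add: whisker_left whisker_right vcomp_reassoc pentagon'[symmetric]
      assoc_nat[THEN prolong] triangle'[symmetric])

lemma triangle_right:
  assumes [simp]: "y \<in> Cell1 \<BB>" "trg \<BB> y = B"
  shows "(\<iota> fs \<star> counit y) \<cdot> unit (fs \<odot> y) = \<iota> (fs \<odot> y)"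
proof -
  have "(\<iota> fs \<star> counit y) \<cdot> unit (fs \<odot> y)
      = (\<iota> fs \<star> counit y) \<cdot> \<a> fs f (fs \<odot> y) \<cdot> (\<eta> \<star> \<iota> (fs \<odot> y)) \<cdot> \<a> (\<U> A) fs y \<cdot> (inv2 \<BB> (\<l> fs) \<star> \<iota> y)"
    by (simp add: unit_def inv_lunit_comp)
  also have "\<dots> = (\<iota> fs \<star> counit y) \<cdot> \<a> fs f (fs \<odot> y) \<cdot> \<a> (fs \<odot> f) fs y \<cdot> ((\<eta> \<star> \<iota> fs) \<star> \<iota> y) \<cdot> (inv2 \<BB> (\<l> fs) \<star> \<iota> y)"
    by (simp add: assoc_nat_left[THEN prolong] vcomp_reassoc)
  also have "\<dots> = (\<iota> fs \<star> counit y) \<cdot> (\<a> fs f (fs \<odot> y) \<cdot> \<a> (fs \<odot> f) fs y) \<cdot> ((\<eta> \<star> \<iota> fs) \<star> \<iota> y) \<cdot> (inv2 \<BB> (\<l> fs) \<star> \<iota> y)"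
    by (simp add: vcomp_reassoc)
  also have "\<dots> = (counit' fs \<star> \<iota> y) \<cdot> ((\<eta> \<star> \<iota> fs) \<star> \<iota> y) \<cdot> (inv2 \<BB> (\<l> fs) \<star> \<iota> y)"
    by (simp add: whisker_counit[THEN prolong])
  also have "\<dots> = (counit' fs \<cdot> (\<eta> \<star> \<iota> fs) \<cdot> inv2 \<BB> (\<l> fs)) \<star> \<iota> y"
    by (simp add: whisker_right)
  also have "\<dots> = \<iota> (fs \<odot> y)" by (simp add: zigzag)
  finally show ?thesis .
qed

lemma triangle'_left:
  assumes "x \<in> Cell1 \<BB>" "src \<BB> x = A"
  shows "counit' (x \<odot> fs) \<cdot> (unit' x \<star> \<iota> fs) = \<iota> (x \<odot> fs)"
  using bicategory_adjunction.triangle_left[OF adjunction_op_bicat, of x] assms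
  by (simp add: op_bicat_unit op_bicat_counit)

lemma triangle'_right:
  assumes "y \<in> Cell1 \<BB>" "src \<BB> y = B"
  shows "(counit' y \<star> \<iota> f) \<cdot> unit' (y \<odot> f) = \<iota> (y \<odot> f)"
  using bicategory_adjunction.triangle_right[OF adjunction_op_bicat, of y] assms
  by (simp add: op_bicat_unit op_bicat_counit)

text \<open>
The counit commutes with whiskering on the far side, since \<open>\<epsilon>\<close> does not touch the factor \<open>x\<close>.
\<close>
lemma counit_strength:
  assumes [simp]: "x \<in> Cell1 \<BB>" "y \<in> Cell1 \<BB>" "trg \<BB> y = B" "src \<BB> y = trg \<BB> x"
  shows "counit (y \<odot> x) \<cdot> (\<iota> f \<star> \<a> fs y x) \<cdot> \<a> f (fs \<odot> y) x = counit y \<star> \<iota> x"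
proof -
  have "counit (y \<odot> x) \<cdot> (\<iota> f \<star> \<a> fs y x) \<cdot> \<a> f (fs \<odot> y) x
      = \<l> (y \<odot> x) \<cdot> (\<epsilon> \<star> \<iota> (y \<odot> x)) \<cdot> \<a> (f \<odot> fs) y x \<cdot> (inv2 \<BB> (\<a> f fs y) \<star> \<iota> x)"
    by (simp add: counit_def vcomp_reassoc pentagon_mixed)
  also have "\<dots> = counit y \<star> \<iota> x"
    by (simp add: counit_def assoc_nat_left[THEN prolong] whisker_right vcomp_reassoc lunit_comp[symmetric])
  finally show ?thesis .
qed

lemma unit'_strength:
  assumes [simp]: "x \<in> Cell1 \<BB>" "y \<in> Cell1 \<BB>" "src \<BB> x = A" "src \<BB> y = trg \<BB> x"
  shows "\<a> y (x \<odot> fs) f \<cdot> (\<a> y x fs \<star> \<iota> f) \<cdot> unit' (y \<odot> x) = \<iota> y \<star> unit' x"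
  unfolding unit'_def
  by (simp add: whisker_left inv_runit_comp vcomp_reassoc pentagon_mixed'[THEN prolong3]
      assoc_nat_right[THEN prolong])

section \<open>Mates, comonoid endomorphisms and coalgebra structures\<close>

lemma adj_mult_eq: "adj_mult \<BB> f fs \<epsilon> = (\<iota> fs \<star> counit f) \<cdot> \<a> fs f (fs \<odot> f)"
  by (simp add: adj_mult_def counit_def whisker_left vcomp_reassoc)

lemma adj_comult_eq: "adj_comult \<BB> f fs \<eta> = \<a> (f \<odot> fs) f fs \<cdot> (unit' f \<star> \<iota> fs)"
  by (simp add: adj_comult_def rebracket_def unit'_def whisker_right vcomp_reassoc)

lemma xi_left_eq:
  assumes "i \<in> Cell2 \<BB>" "cod2 \<BB> i = fs \<odot> f"
  shows "xi_left \<BB> f fs \<epsilon> i = counit f \<cdot> (\<iota> f \<star> i)"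
proof -
  have "trg \<BB> (dom2 \<BB> i) = A" using dom_cod_cell(4)[OF assms(1)] assms(2) by simp
  then show ?thesis using assms by (simp add: xi_left_def counit_def vcomp_reassoc)
qed

text \<open>
Reversal brackets the formulas for multiplication and comultiplication differently; the
results agree by coherence.
\<close>
lemma op_bicat_adj_mult: "adj_mult (op_bicat \<BB>) fs f \<epsilon> = adj_mult \<BB> f fs \<epsilon>"
  by (simp add: bicategory_adjunction.adj_mult_eq[OF adjunction_op_bicat] op_bicat_counit adj_mult_eq
      vcomp_reassoc flip: whisker_counit)

lemma op_bicat_adj_comult: "adj_comult (op_bicat \<BB>) fs f \<eta> = adj_comult \<BB> f fs \<eta>"
  by (simp add: bicategory_adjunction.adj_comult_eq[OF adjunction_op_bicat] op_bicat_unit' adj_comult_eq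
      flip: whisker_unit)

text \<open>
The bijection between 2-cells \<open>f \<otimes> f\<^sup>* \<rightarrow> f \<otimes> f\<^sup>*\<close> and \<open>f \<rightarrow> f \<otimes> f\<^sup>* \<otimes> f\<close> given by the adjunction
\<open>- \<otimes> f\<^sup>* \<stileturn> - \<otimes> f\<close>.  The inverse is spelled with the constraints occurring in \<open>\<Gamma>\<^sub>f\<close>.
\<close>
definition mate :: "'c \<Rightarrow> 'c" where
  "mate \<phi> = \<a> f fs f \<cdot> (\<phi> \<star> \<iota> f) \<cdot> unit' f"

definition unmate :: "'c \<Rightarrow> 'c" where
  "unmate c = \<r> (f \<odot> fs) \<cdot> (\<iota> (f \<odot> fs) \<star> \<epsilon>) \<cdot> rebracket \<BB> f fs \<cdot> (c \<star> \<iota> fs)"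

lemma unmate_eq:
  assumes "c \<in> Cell2 \<BB>" "dom2 \<BB> c = f" "cod2 \<BB> c = f \<odot> fs \<odot> f"
  shows "unmate c = counit' (f \<odot> fs) \<cdot> ((inv2 \<BB> (\<a> f fs f) \<cdot> c) \<star> \<iota> fs)"
  using assms by (simp add: unmate_def rebracket_def counit'_def whisker_right vcomp_reassoc)

lemma mate_cell [simp]:
  assumes "\<phi> \<in> Cell2 \<BB>" "dom2 \<BB> \<phi> = f \<odot> fs" "cod2 \<BB> \<phi> = f \<odot> fs"
  shows "mate \<phi> \<in> Cell2 \<BB>" "dom2 \<BB> (mate \<phi>) = f" "cod2 \<BB> (mate \<phi>) = f \<odot> fs \<odot> f"
  using assms by (simp_all add: mate_def)

lemma unmate_cell [simp]:
  assumes "c \<in> Cell2 \<BB>" "dom2 \<BB> c = f" "cod2 \<BB> c = f \<odot> fs \<odot> f"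
  shows "unmate c \<in> Cell2 \<BB>" "dom2 \<BB> (unmate c) = f \<odot> fs" "cod2 \<BB> (unmate c) = f \<odot> fs"
  using assms by (simp_all add: unmate_eq)

lemma unmate_mate_general:
  assumes "\<psi> \<in> Cell2 \<BB>" "dom2 \<BB> \<psi> = f \<odot> fs" "cod2 \<BB> \<psi> = y"
  shows "counit' y \<cdot> (((\<psi> \<star> \<iota> f) \<cdot> unit' f) \<star> \<iota> fs) = \<psi>"
proof -
  have [simp]: "y \<in> Cell1 \<BB>" "src \<BB> y = B" using assms dom_cod_cell[of \<psi>] by auto
  show ?thesis
    using assms by (simp add: whisker_right counit'_nat[THEN prolong] triangle'_left vcomp_reassoc)
qed

text \<open>
Transposition is injective for any target \<open>y\<close>.  Equations between 2-cells out of the comonoid,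
such as those defining comonoid endomorphisms, can hence be tested on transposes.
\<close>
lemma mate_inj:
  assumes "(\<psi> \<star> \<iota> f) \<cdot> unit' f = (\<psi>' \<star> \<iota> f) \<cdot> unit' f"
    "\<psi> \<in> Cell2 \<BB>" "dom2 \<BB> \<psi> = f \<odot> fs" "cod2 \<BB> \<psi> = y"
    "\<psi>' \<in> Cell2 \<BB>" "dom2 \<BB> \<psi>' = f \<odot> fs" "cod2 \<BB> \<psi>' = y"
  shows "\<psi> = \<psi>'"
  using unmate_mate_general[OF assms(2-4)] unmate_mate_general[OF assms(5-7)]
  unfolding assms(1) by (rule trans[OF sym])

lemma unmate_mate:
  assumes "\<phi> \<in> Cell2 \<BB>" "dom2 \<BB> \<phi> = f \<odot> fs" "cod2 \<BB> \<phi> = f \<odot> fs"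
  shows "unmate (mate \<phi>) = \<phi>"
proof -
  have "inv2 \<BB> (\<a> f fs f) \<cdot> mate \<phi> = (\<phi> \<star> \<iota> f) \<cdot> unit' f" using assms by (simp add: mate_def)
  then show ?thesis using assms unmate_mate_general[OF assms] by (simp only: unmate_eq mate_cell)
qed

lemma mate_unmate:
  assumes [simp]: "c \<in> Cell2 \<BB>" "dom2 \<BB> c = f" "cod2 \<BB> c = f \<odot> fs \<odot> f"
  shows "mate (unmate c) = c"
proof -
  let ?d = "inv2 \<BB> (\<a> f fs f) \<cdot> c"
  have "mate (unmate c) = \<a> f fs f \<cdot> (counit' (f \<odot> fs) \<star> \<iota> f) \<cdot> ((?d \<star> \<iota> fs) \<star> \<iota> f) \<cdot> unit' f"
    by (simp add: mate_def unmate_eq whisker_right vcomp_reassoc)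
  also have "((?d \<star> \<iota> fs) \<star> \<iota> f) \<cdot> unit' f = unit' ((f \<odot> fs) \<odot> f) \<cdot> ?d"
    using unit'_nat[of ?d "(f \<odot> fs) \<odot> f"] by simp
  finally show ?thesis by (simp add: triangle'_right[THEN prolong])
qed

text \<open>
Coalgebra structures on the object \<open>f\<close> for the comonad \<open>f \<otimes> f\<^sup>* \<otimes> -\<close>, whose comultiplication at \<open>f\<close> is
\<open>f \<otimes> unit (f\<^sup>* \<otimes> f)\<close>.
\<close>
definition coalgebra :: "'c \<Rightarrow> bool" where
  "coalgebra c \<longleftrightarrow> c \<in> Cell2 \<BB> \<and> dom2 \<BB> c = f \<and> cod2 \<BB> c = f \<odot> fs \<odot> f \<and>
     counit f \<cdot> c = \<iota> f \<and> (\<iota> f \<star> unit (fs \<odot> f)) \<cdot> c = (\<iota> f \<star> \<iota> fs \<star> c) \<cdot> c"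

lemma counital_iff:
  assumes [simp]: "\<phi> \<in> Cell2 \<BB>" "dom2 \<BB> \<phi> = f \<odot> fs" "cod2 \<BB> \<phi> = f \<odot> fs"
  shows "\<epsilon> \<cdot> \<phi> = \<epsilon> \<longleftrightarrow> counit f \<cdot> mate \<phi> = \<iota> f"
proof -
  have c: "counit f \<cdot> mate \<phi> = \<l> f \<cdot> ((\<epsilon> \<cdot> \<phi>) \<star> \<iota> f) \<cdot> unit' f"
    by (simp add: mate_def counit_def whisker_right vcomp_reassoc)
  have "\<epsilon> \<cdot> \<phi> = \<epsilon>" if "counit f \<cdot> mate \<phi> = \<iota> f"
  proof (rule mate_inj)
    show "((\<epsilon> \<cdot> \<phi>) \<star> \<iota> f) \<cdot> unit' f = (\<epsilon> \<star> \<iota> f) \<cdot> unit' f"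
      by (rule iso2_cancel_left[of "\<l> f"]) (use that c in \<open>simp_all add: zigzag\<close>)
  qed simp_all
  then show ?thesis using c by (auto simp: zigzag)
qed

text \<open>
Transposing both sides of \<open>\<delta> \<cdot> \<phi> = (\<phi> \<star> \<phi>) \<cdot> \<delta>\<close> gives, up to the rebracketing \<open>\<kappa>\<close>, both sides of
coassociativity.  On the right-hand side this uses that the two ways of inserting \<open>\<eta>\<close> twice
after \<open>f\<close> agree, after which each copy of \<open>\<phi>\<close> meets its own \<open>\<eta>\<close>.
\<close>
lemma coassociative_iff:
  assumes [simp]: "\<phi> \<in> Cell2 \<BB>" "dom2 \<BB> \<phi> = f \<odot> fs" "cod2 \<BB> \<phi> = f \<odot> fs"
  defines "\<delta> \<equiv> adj_comult \<BB> f fs \<eta>" and "c \<equiv> mate \<phi>"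
  shows "\<delta> \<cdot> \<phi> = (\<phi> \<star> \<phi>) \<cdot> \<delta> \<longleftrightarrow> (\<iota> f \<star> unit (fs \<odot> f)) \<cdot> c = (\<iota> f \<star> \<iota> fs \<star> c) \<cdot> c"
proof -
  let ?C = "f \<odot> fs" and ?S = "fs \<odot> f"
  (* the rebracketing \<open>((f \<odot> fs) \<odot> (f \<odot> fs)) \<odot> f \<rightarrow> f \<odot> fs \<odot> f \<odot> fs \<odot> f\<close> *)
  define \<kappa> where "\<kappa> = \<a> f fs (f \<odot> ?S) \<cdot> (\<iota> ?C \<star> \<a> f fs f) \<cdot> \<a> ?C ?C f"
  have \<delta>: "\<delta> = \<a> ?C f fs \<cdot> (unit' f \<star> \<iota> fs)" unfolding \<delta>_def by (rule adj_comult_eq)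
  have [simp]: "\<delta> \<in> Cell2 \<BB>" "dom2 \<BB> \<delta> = ?C" "cod2 \<BB> \<delta> = ?C \<odot> ?C" by (simp_all add: \<delta>)
  have [simp]: "c \<in> Cell2 \<BB>" "dom2 \<BB> c = f" "cod2 \<BB> c = f \<odot> ?S" by (simp_all add: c_def)
  have iso: "iso2 \<BB> \<kappa>" unfolding \<kappa>_def by (intro iso2_vcomp) simp_all
  have [simp]: "\<kappa> \<in> Cell2 \<BB>" "dom2 \<BB> \<kappa> = (?C \<odot> ?C) \<odot> f" by (simp_all add: \<kappa>_def)
  have 1: "\<kappa> \<cdot> ((\<delta> \<cdot> \<phi>) \<star> \<iota> f) \<cdot> unit' f = (\<iota> f \<star> unit ?S) \<cdot> c"
  proof -
    have "\<kappa> \<cdot> (\<delta> \<star> \<iota> f) = \<a> f fs (f \<odot> ?S) \<cdot> ((\<iota> ?C \<star> \<a> f fs f) \<cdot> \<a> ?C ?C f \<cdot> (\<a> ?C f fs \<star> \<iota> f)) \<cdot>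
        ((unit' f \<star> \<iota> fs) \<star> \<iota> f)"
      by (simp add: \<kappa>_def \<delta> whisker_right vcomp_reassoc)
    also have "\<dots> = (\<a> f fs (f \<odot> ?S) \<cdot> \<a> ?C f ?S \<cdot> (unit' f \<star> \<iota> ?S)) \<cdot> \<a> f fs f"
      by (simp add: pentagon' assoc_nat_left vcomp_reassoc)
    also have "\<dots> = (\<iota> f \<star> unit ?S) \<cdot> \<a> f fs f" by (simp add: whisker_unit)
    finally have "\<kappa> \<cdot> (\<delta> \<star> \<iota> f) = (\<iota> f \<star> unit ?S) \<cdot> \<a> f fs f" .
    from prolong[OF this, of "(\<phi> \<star> \<iota> f) \<cdot> unit' f"] show ?thesis
      by (simp add: whisker_right vcomp_reassoc c_def mate_def)
  qed
  have 2: "\<kappa> \<cdot> (((\<phi> \<star> \<phi>) \<cdot> \<delta>) \<star> \<iota> f) \<cdot> unit' f = (\<iota> f \<star> \<iota> fs \<star> c) \<cdot> c"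
  proof -
    (* the second \<open>\<eta>\<close> goes to the left of the first one on one side, to its right on the other *)
    have d: "\<a> ?C ?C f \<cdot> (\<delta> \<star> \<iota> f) \<cdot> unit' f = (\<iota> ?C \<star> unit' f) \<cdot> unit' f"
    proof -
      have "\<a> ?C ?C f \<cdot> (\<delta> \<star> \<iota> f) \<cdot> unit' f = \<a> ?C ?C f \<cdot> (\<a> ?C f fs \<star> \<iota> f) \<cdot> unit' (?C \<odot> f) \<cdot> unit' f"
        by (simp add: \<delta> whisker_right vcomp_reassoc unit'_nat)
      also have "\<dots> = (\<iota> ?C \<star> unit' f) \<cdot> unit' f"
        by (simp add: unit'_strength[THEN prolong3])
      finally show ?thesis .
    qed
    have "\<kappa> \<cdot> (((\<phi> \<star> \<phi>) \<cdot> \<delta>) \<star> \<iota> f) \<cdot> unit' f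
      = \<a> f fs (f \<odot> ?S) \<cdot> (\<iota> ?C \<star> \<a> f fs f) \<cdot> (\<phi> \<star> (\<phi> \<star> \<iota> f)) \<cdot> (\<iota> ?C \<star> unit' f) \<cdot> unit' f"
      by (simp add: \<kappa>_def whisker_right vcomp_reassoc assoc_nat[THEN prolong] d)
    also have "\<dots> = \<a> f fs (f \<odot> ?S) \<cdot> (\<phi> \<star> c) \<cdot> unit' f"
      by (simp add: c_def mate_def hcomp_vcomp hcomp_vcomp[THEN prolong])
    also have "(\<phi> \<star> c) = (\<iota> ?C \<star> c) \<cdot> (\<phi> \<star> \<iota> f)" by (simp add: hcomp_vcomp)
    also have "\<a> f fs (f \<odot> ?S) \<cdot> ((\<iota> ?C \<star> c) \<cdot> (\<phi> \<star> \<iota> f)) \<cdot> unit' f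
      = (\<iota> f \<star> \<iota> fs \<star> c) \<cdot> \<a> f fs f \<cdot> (\<phi> \<star> \<iota> f) \<cdot> unit' f"
      by (simp add: vcomp_reassoc assoc_nat_right[THEN prolong])
    also have "\<dots> = (\<iota> f \<star> \<iota> fs \<star> c) \<cdot> c" by (simp add: c_def mate_def)
    finally show ?thesis .
  qed
  have "\<delta> \<cdot> \<phi> = (\<phi> \<star> \<phi>) \<cdot> \<delta>" if e: "(\<iota> f \<star> unit ?S) \<cdot> c = (\<iota> f \<star> \<iota> fs \<star> c) \<cdot> c"
  proof (rule mate_inj)
    show "((\<delta> \<cdot> \<phi>) \<star> \<iota> f) \<cdot> unit' f = (((\<phi> \<star> \<phi>) \<cdot> \<delta>) \<star> \<iota> f) \<cdot> unit' f"
      by (rule iso2_cancel_left[OF iso]) (use e 1 2 in simp_all)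
  qed simp_all
  then show ?thesis using 1 2 by auto
qed

abbreviation endo :: "'c monoid" where
  "endo \<equiv> comonoid_End \<BB> (f \<odot> fs) (adj_comult \<BB> f fs \<eta>) \<epsilon>"

lemma endo_carrier:
  "\<phi> \<in> carrier endo \<longleftrightarrow>
     \<phi> \<in> Cell2 \<BB> \<and> dom2 \<BB> \<phi> = f \<odot> fs \<and> cod2 \<BB> \<phi> = f \<odot> fs \<and> coalgebra (mate \<phi>)"
  using coassociative_iff[of \<phi>] counital_iff[of \<phi>]
  by (auto simp: comonoid_End_def in_hom2_def coalgebra_def)

lemma monoid_endo: "monoid endo"
proof (rule monoidI, goal_cases)
  case (1 \<phi> \<psi>)
  let ?d = "adj_comult \<BB> f fs \<eta>"
  have [simp]: "?d \<in> Cell2 \<BB>" "dom2 \<BB> ?d = f \<odot> fs" "cod2 \<BB> ?d = (f \<odot> fs) \<odot> f \<odot> fs"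
    by (simp_all add: adj_comult_eq)
  from 1 have *: "\<phi> \<in> Cell2 \<BB>" "dom2 \<BB> \<phi> = f \<odot> fs" "cod2 \<BB> \<phi> = f \<odot> fs" "?d \<cdot> \<phi> = (\<phi> \<star> \<phi>) \<cdot> ?d" "\<epsilon> \<cdot> \<phi> = \<epsilon>"
    "\<psi> \<in> Cell2 \<BB>" "dom2 \<BB> \<psi> = f \<odot> fs" "cod2 \<BB> \<psi> = f \<odot> fs" "?d \<cdot> \<psi> = (\<psi> \<star> \<psi>) \<cdot> ?d" "\<epsilon> \<cdot> \<psi> = \<epsilon>"
    by (auto simp: comonoid_End_def in_hom2_def)
  have "?d \<cdot> \<phi> \<cdot> \<psi> = (\<phi> \<star> \<phi>) \<cdot> ?d \<cdot> \<psi>" using * by (simp add: *(4)[THEN prolong] vcomp_reassoc)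
  also have "\<dots> = ((\<phi> \<cdot> \<psi>) \<star> (\<phi> \<cdot> \<psi>)) \<cdot> ?d" using * by (simp flip: hcomp_vcomp add: vcomp_reassoc)
  finally show ?case using * *(5)[THEN prolong] by (simp add: comonoid_End_def in_hom2_def)
next
  case 2
  have [simp]: "adj_comult \<BB> f fs \<eta> \<in> Cell2 \<BB>" "dom2 \<BB> (adj_comult \<BB> f fs \<eta>) = f \<odot> fs"
    "cod2 \<BB> (adj_comult \<BB> f fs \<eta>) = (f \<odot> fs) \<odot> f \<odot> fs"
    by (simp_all add: adj_comult_eq)
  show ?case by (simp add: comonoid_End_def in_hom2_def)
qed (auto simp: comonoid_End_def in_hom2_def vcomp_reassoc)

text \<open>
The \<open>\<eta>\<close> contained in the mate is cancelled by the \<open>\<epsilon>\<close> contained in the multiplication of \<open>S\<^sub>f\<close>.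
\<close>
lemma mate_mult:
  assumes [simp]: "\<phi> \<in> Cell2 \<BB>" "dom2 \<BB> \<phi> = f \<odot> fs" "cod2 \<BB> \<phi> = f \<odot> fs"
  shows "(\<iota> f \<star> adj_mult \<BB> f fs \<epsilon>) \<cdot> \<a> f (fs \<odot> f) (fs \<odot> f) \<cdot> (mate \<phi> \<star> \<iota> (fs \<odot> f))
    = \<a> f fs f \<cdot> (\<phi> \<star> \<iota> f) \<cdot> inv2 \<BB> (\<a> f fs f)"
proof -
  let ?C = "f \<odot> fs" and ?S = "fs \<odot> f"
  have "(\<iota> f \<star> adj_mult \<BB> f fs \<epsilon>) \<cdot> \<a> f ?S ?S \<cdot> (mate \<phi> \<star> \<iota> ?S)
    = (\<iota> f \<star> \<iota> fs \<star> counit f) \<cdot> ((\<iota> f \<star> \<a> fs f ?S) \<cdot> \<a> f ?S ?S \<cdot> (\<a> f fs f \<star> \<iota> ?S)) \<cdot>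
      ((\<phi> \<star> \<iota> f) \<star> \<iota> ?S) \<cdot> (unit' f \<star> \<iota> ?S)"
    by (simp add: adj_mult_eq mate_def whisker_left whisker_right vcomp_reassoc)
  also have "\<dots> = (\<iota> f \<star> \<iota> fs \<star> counit f) \<cdot> \<a> f fs (f \<odot> ?S) \<cdot> (\<phi> \<star> \<iota> (f \<odot> ?S)) \<cdot>
      \<a> ?C f ?S \<cdot> (unit' f \<star> \<iota> ?S)"
    by (simp add: pentagon' vcomp_reassoc assoc_nat_left[THEN prolong])
  also have "\<dots> = \<a> f fs f \<cdot> (\<iota> ?C \<star> counit f) \<cdot> (\<phi> \<star> \<iota> (f \<odot> ?S)) \<cdot> \<a> ?C f ?S \<cdot> (unit' f \<star> \<iota> ?S)"
    by (simp add: assoc_nat_right[of "counit f" fs f f, THEN prolong] vcomp_reassoc)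
  also have "\<dots> = \<a> f fs f \<cdot> (\<phi> \<star> \<iota> f) \<cdot> (\<iota> ?C \<star> counit f) \<cdot> \<a> ?C f ?S \<cdot> (unit' f \<star> \<iota> ?S)"
    by (simp add: whisker_exchange[of "counit f" \<phi> f "f \<odot> fs", THEN prolong] vcomp_reassoc)
  also have "\<a> ?C f ?S \<cdot> (unit' f \<star> \<iota> ?S) = inv2 \<BB> (\<a> f fs (f \<odot> ?S)) \<cdot> (\<iota> f \<star> unit ?S)"
    by (simp flip: whisker_unit)
  also have "(\<iota> ?C \<star> counit f) \<cdot> inv2 \<BB> (\<a> f fs (f \<odot> ?S)) \<cdot> (\<iota> f \<star> unit ?S)
     = inv2 \<BB> (\<a> f fs f) \<cdot> (\<iota> f \<star> \<iota> fs \<star> counit f) \<cdot> (\<iota> f \<star> unit ?S)"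
    using assoc_inv_nat[of "counit f" "\<iota> fs" "\<iota> f" f fs f, THEN prolong,
        of "\<iota> f \<star> unit ?S"]
    by (simp add: vcomp_reassoc)
  also have "(\<iota> f \<star> \<iota> fs \<star> counit f) \<cdot> (\<iota> f \<star> unit ?S) = \<iota> (f \<odot> ?S)"
    by (simp add: triangle_right flip: whisker_left)
  finally show ?thesis by simp
qed

text \<open>
Without constraints: \<open>\<xi>\<close> of the product of \<open>i\<close> and \<open>j\<close> is \<open>\<xi>\<^sub>j \<cdot> (\<xi>\<^sub>i \<otimes> J)\<close>, because the two
occurrences of \<open>\<epsilon>\<close> can be applied from left to right.
\<close>
lemma xi_mult:
  assumes [simp]: "i \<in> Cell2 \<BB>" "cod2 \<BB> i = fs \<odot> f" "j \<in> Cell2 \<BB>" "cod2 \<BB> j = fs \<odot> f"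
  shows "counit f \<cdot> (\<iota> f \<star> (adj_mult \<BB> f fs \<epsilon> \<cdot> (i \<star> j)))
    = (counit f \<cdot> (\<iota> f \<star> j)) \<cdot> ((counit f \<cdot> (\<iota> f \<star> i)) \<star> \<iota> (dom2 \<BB> j)) \<cdot> inv2 \<BB> (\<a> f (dom2 \<BB> i) (dom2 \<BB> j))"
proof -
  let ?C = "f \<odot> fs" and ?S = "fs \<odot> f"
  have [simp]: "src \<BB> (dom2 \<BB> i) = A" "trg \<BB> (dom2 \<BB> i) = A" "src \<BB> (dom2 \<BB> j) = A" "trg \<BB> (dom2 \<BB> j) = A"
    using dom_cod_cell(3,4)[of i] dom_cod_cell(3,4)[of j] by simp_all
  have "counit f \<cdot> (\<iota> f \<star> (adj_mult \<BB> f fs \<epsilon> \<cdot> (i \<star> j)))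
    = (counit f \<cdot> (\<iota> f \<star> \<iota> fs \<star> counit f)) \<cdot> (\<iota> f \<star> \<a> fs f ?S) \<cdot> (\<iota> f \<star> (i \<star> j))"
    by (simp add: adj_mult_eq whisker_left vcomp_reassoc)
  also have "\<dots> = counit f \<cdot> counit (f \<odot> ?S) \<cdot> (\<iota> f \<star> \<a> fs f ?S) \<cdot> (\<iota> f \<star> (i \<star> j))"
    by (simp add: counit_nat vcomp_reassoc)
  also have "(\<iota> f \<star> (i \<star> j)) = \<a> f ?S ?S \<cdot> ((\<iota> f \<star> i) \<star> j) \<cdot> inv2 \<BB> (\<a> f (dom2 \<BB> i) (dom2 \<BB> j))"
    by (simp add: assoc_nat[THEN prolong] vcomp_reassoc)
  also have "counit (f \<odot> ?S) \<cdot> (\<iota> f \<star> \<a> fs f ?S) \<cdot> \<dots>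
    = (counit f \<star> \<iota> ?S) \<cdot> ((\<iota> f \<star> i) \<star> j) \<cdot> inv2 \<BB> (\<a> f (dom2 \<BB> i) (dom2 \<BB> j))"
    by (simp add: counit_strength[THEN prolong3])
  also have "\<dots> = ((counit f \<cdot> (\<iota> f \<star> i)) \<star> j) \<cdot> inv2 \<BB> (\<a> f (dom2 \<BB> i) (dom2 \<BB> j))"
    by (simp add: hcomp_vcomp[THEN prolong])
  also have "(counit f \<cdot> (\<iota> f \<star> i)) \<star> j = (\<iota> f \<star> j) \<cdot> ((counit f \<cdot> (\<iota> f \<star> i)) \<star> \<iota> (dom2 \<BB> j))"
    by (simp add: hcomp_vcomp)
  finally show ?thesis by (simp add: vcomp_reassoc)
qed

end

context bicategory
begin

section \<open>Equalizers and monomorphisms\<close>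

lemma equalizer_cell:
  assumes "is_equalizer \<BB> e u v"
  shows "e \<in> Cell2 \<BB>" "u \<in> Cell2 \<BB>" "v \<in> Cell2 \<BB>" "dom2 \<BB> u = cod2 \<BB> e" "dom2 \<BB> v = cod2 \<BB> e"
    "cod2 \<BB> v = cod2 \<BB> u" "u \<cdot> e = v \<cdot> e"
  using assms by (auto simp: is_equalizer_def in_hom2_def)

lemma equalizer_universal:
  assumes "is_equalizer \<BB> e u v" "in_hom2 \<BB> t w (cod2 \<BB> e)" "u \<cdot> t = v \<cdot> t"
  shows "\<exists>!s. in_hom2 \<BB> s w (dom2 \<BB> e) \<and> e \<cdot> s = t"
proof -
  obtain x y where e: "in_hom2 \<BB> e x y"
    and *: "\<And>w t. in_hom2 \<BB> t w y \<and> u \<cdot> t = v \<cdot> t \<longrightarrow> (\<exists>!s. in_hom2 \<BB> s w x \<and> e \<cdot> s = t)"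
    using assms(1) unfolding is_equalizer_def by metis
  from e have "x = dom2 \<BB> e" "y = cod2 \<BB> e" by (auto simp: in_hom2_def)
  then show ?thesis using * assms(2,3) by metis
qed

lemma equalizer_factor:
  assumes "is_equalizer \<BB> e u v" "t \<in> Cell2 \<BB>" "cod2 \<BB> t = cod2 \<BB> e" "u \<cdot> t = v \<cdot> t"
  obtains s where "s \<in> Cell2 \<BB>" "dom2 \<BB> s = dom2 \<BB> t" "cod2 \<BB> s = dom2 \<BB> e" "e \<cdot> s = t"
  using equalizer_universal[OF assms(1) _ assms(4), of "dom2 \<BB> t"] assms(2,3)
  unfolding in_hom2_def by metis

lemma equalizer_cancel:
  assumes "is_equalizer \<BB> e u v" "s \<in> Cell2 \<BB>" "s' \<in> Cell2 \<BB>" "dom2 \<BB> s = dom2 \<BB> s'"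
    "cod2 \<BB> s = dom2 \<BB> e" "cod2 \<BB> s' = dom2 \<BB> e" "e \<cdot> s = e \<cdot> s'"
  shows "s = s'"
proof -
  note e [simp] = equalizer_cell(1-6)[OF assms(1)]
  have "(u \<cdot> e) \<cdot> s = (v \<cdot> e) \<cdot> s" by (simp only: equalizer_cell(7)[OF assms(1)])
  then have "u \<cdot> e \<cdot> s = v \<cdot> e \<cdot> s" using assms(2,5) by (simp add: vcomp_reassoc)
  moreover have "in_hom2 \<BB> (e \<cdot> s) (dom2 \<BB> s') (cod2 \<BB> e)"
    unfolding in_hom2_def using assms(2-6) by simp
  ultimately have "\<exists>!r. in_hom2 \<BB> r (dom2 \<BB> s') (dom2 \<BB> e) \<and> e \<cdot> r = e \<cdot> s"
    by (intro equalizer_universal[OF assms(1)])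
  moreover have "in_hom2 \<BB> s (dom2 \<BB> s') (dom2 \<BB> e)" "in_hom2 \<BB> s' (dom2 \<BB> s') (dom2 \<BB> e)"
    unfolding in_hom2_def using assms(2-6) by simp_all
  ultimately show ?thesis using assms(7) by metis
qed

lemma equalizerI:
  assumes "e \<in> Cell2 \<BB>" "u \<in> Cell2 \<BB>" "v \<in> Cell2 \<BB>" "dom2 \<BB> u = cod2 \<BB> e" "dom2 \<BB> v = cod2 \<BB> e"
    "cod2 \<BB> v = cod2 \<BB> u" "u \<cdot> e = v \<cdot> e"
    "\<And>t. t \<in> Cell2 \<BB> \<Longrightarrow> cod2 \<BB> t = cod2 \<BB> e \<Longrightarrow> u \<cdot> t = v \<cdot> t \<Longrightarrow>
      \<exists>s \<in> Cell2 \<BB>. dom2 \<BB> s = dom2 \<BB> t \<and> cod2 \<BB> s = dom2 \<BB> e \<and> e \<cdot> s = t"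
    "\<And>s s'. s \<in> Cell2 \<BB> \<Longrightarrow> s' \<in> Cell2 \<BB> \<Longrightarrow> dom2 \<BB> s = dom2 \<BB> s' \<Longrightarrow> cod2 \<BB> s = dom2 \<BB> e \<Longrightarrow>
      cod2 \<BB> s' = dom2 \<BB> e \<Longrightarrow> e \<cdot> s = e \<cdot> s' \<Longrightarrow> s = s'"
  shows "is_equalizer \<BB> e u v"
proof -
  have "\<exists>!s. in_hom2 \<BB> s w (dom2 \<BB> e) \<and> e \<cdot> s = t"
    if t: "in_hom2 \<BB> t w (cod2 \<BB> e) \<and> u \<cdot> t = v \<cdot> t" for w t
  proof -
    from t assms(8)[of t] obtain s where "in_hom2 \<BB> s w (dom2 \<BB> e) \<and> e \<cdot> s = t"
      by (auto simp: in_hom2_def)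
    then show ?thesis by (rule ex1I) (use assms(9) \<open>_ \<and> e \<cdot> s = t\<close> in \<open>simp add: in_hom2_def\<close>)
  qed
  then show ?thesis
    unfolding is_equalizer_def using assms(1-7)
    by (intro exI[of _ "dom2 \<BB> e"] exI[of _ "cod2 \<BB> e"] exI[of _ "cod2 \<BB> u"]) (simp add: in_hom2_def)
qed

lemma equalizer_transport:
  assumes "is_equalizer \<BB> e u v" "iso2 \<BB> p" "dom2 \<BB> p = cod2 \<BB> e" "iso2 \<BB> q" "cod2 \<BB> q = dom2 \<BB> e"
  shows "is_equalizer \<BB> (p \<cdot> e \<cdot> q) (u \<cdot> inv2 \<BB> p) (v \<cdot> inv2 \<BB> p)"
proof (rule equalizerI)
  note [simp] = equalizer_cell(1-6)[OF assms(1)] assms(2-5) iso2_cell[OF assms(2)] iso2_cell[OF assms(4)]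
  show "(u \<cdot> inv2 \<BB> p) \<cdot> p \<cdot> e \<cdot> q = (v \<cdot> inv2 \<BB> p) \<cdot> p \<cdot> e \<cdot> q"
    by (simp add: vcomp_reassoc equalizer_cell(7)[OF assms(1), THEN prolong])
next
  note [simp] = equalizer_cell(1-6)[OF assms(1)] assms(2-5) iso2_cell[OF assms(2)] iso2_cell[OF assms(4)]
  fix t assume [simp]: "t \<in> Cell2 \<BB>" "cod2 \<BB> t = cod2 \<BB> (p \<cdot> e \<cdot> q)" and e: "(u \<cdot> inv2 \<BB> p) \<cdot> t = (v \<cdot> inv2 \<BB> p) \<cdot> t"
  have "u \<cdot> inv2 \<BB> p \<cdot> t = v \<cdot> inv2 \<BB> p \<cdot> t" using e by (simp add: vcomp_reassoc)
  then obtain s where [simp]: "s \<in> Cell2 \<BB>" "dom2 \<BB> s = dom2 \<BB> t" "cod2 \<BB> s = dom2 \<BB> e" "e \<cdot> s = inv2 \<BB> p \<cdot> t"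
    by (rule equalizer_factor[OF assms(1), rotated 2]) simp_all
  show "\<exists>s \<in> Cell2 \<BB>. dom2 \<BB> s = dom2 \<BB> t \<and> cod2 \<BB> s = dom2 \<BB> (p \<cdot> e \<cdot> q) \<and> (p \<cdot> e \<cdot> q) \<cdot> s = t"
    by (rule bexI[of _ "inv2 \<BB> q \<cdot> s"]) (simp_all add: vcomp_reassoc)
next
  note [simp] = equalizer_cell(1-6)[OF assms(1)] assms(2-5) iso2_cell[OF assms(2)] iso2_cell[OF assms(4)]
  fix s s' assume [simp]: "s \<in> Cell2 \<BB>" "s' \<in> Cell2 \<BB>" "dom2 \<BB> s = dom2 \<BB> s'" "cod2 \<BB> s = dom2 \<BB> (p \<cdot> e \<cdot> q)"
    "cod2 \<BB> s' = dom2 \<BB> (p \<cdot> e \<cdot> q)" and e: "(p \<cdot> e \<cdot> q) \<cdot> s = (p \<cdot> e \<cdot> q) \<cdot> s'"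
  have "e \<cdot> q \<cdot> s = e \<cdot> q \<cdot> s'"
    by (rule iso2_cancel_left[OF assms(2)]) (use e in \<open>simp_all add: vcomp_reassoc\<close>)
  then have "q \<cdot> s = q \<cdot> s'" by (rule equalizer_cancel[OF assms(1), rotated -1]) simp_all
  then show "s = s'" by (rule iso2_cancel_left[OF assms(4)]) simp_all
qed (use equalizer_cell[OF assms(1)] assms iso2_cell in simp_all)

lemma mono2I:
  assumes "i \<in> Cell2 \<BB>"
    "\<And>u v. u \<in> Cell2 \<BB> \<Longrightarrow> v \<in> Cell2 \<BB> \<Longrightarrow> dom2 \<BB> u = dom2 \<BB> v \<Longrightarrow> cod2 \<BB> u = dom2 \<BB> i \<Longrightarrow>
       cod2 \<BB> v = dom2 \<BB> i \<Longrightarrow> i \<cdot> u = i \<cdot> v \<Longrightarrow> u = v"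
  shows "mono2 \<BB> i"
  using assms by (auto simp: mono2_def in_hom2_def)

lemma mono2D:
  assumes "mono2 \<BB> i" "i \<cdot> u = i \<cdot> v" "u \<in> Cell2 \<BB>" "v \<in> Cell2 \<BB>" "dom2 \<BB> u = dom2 \<BB> v" "cod2 \<BB> u = dom2 \<BB> i"
       "cod2 \<BB> v = dom2 \<BB> i"
  shows "u = v"
  using assms by (auto simp: mono2_def in_hom2_def)

end

context bicategory_adjunction
begin

section \<open>Invertible subobjects as coalgebra structures\<close>

abbreviation S :: 'm where "S \<equiv> fs \<odot> f"
abbreviation m :: 'c where "m \<equiv> adj_mult \<BB> f fs \<epsilon>"

definition xi :: "'c \<Rightarrow> 'c" where "xi i = counit f \<cdot> (\<iota> f \<star> i)"

text \<open>
By \<open>invertible_iff\<close> these are the representatives of the elements of \<open>\<^bold>I\<^sup>l(S\<^sub>f)\<close>; that they are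
monomorphisms follows from purity.
\<close>
definition invertible :: "'c \<Rightarrow> bool" where
  "invertible i \<longleftrightarrow> i \<in> Cell2 \<BB> \<and> cod2 \<BB> i = S \<and> iso2 \<BB> (xi i)"

text \<open>
The cofree coalgebra structure of \<open>f \<otimes> J\<close> transported to \<open>f\<close> along \<open>\<xi>\<^sub>i\<close>.
\<close>
definition coact :: "'c \<Rightarrow> 'c" where
  "coact i = (\<iota> f \<star> i) \<cdot> inv2 \<BB> (xi i)"

lemma into_S_cell:
  assumes "i \<in> Cell2 \<BB>" "cod2 \<BB> i = S"
  shows "src \<BB> (dom2 \<BB> i) = A" "trg \<BB> (dom2 \<BB> i) = A"
  using dom_cod_cell(3,4)[OF assms(1)] assms(2) by simp_all

lemma xi_cell [simp]:
  assumes "i \<in> Cell2 \<BB>" "cod2 \<BB> i = S"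
  shows "xi i \<in> Cell2 \<BB>" "dom2 \<BB> (xi i) = f \<odot> dom2 \<BB> i" "cod2 \<BB> (xi i) = f"
  using assms by (simp_all add: xi_def into_S_cell)

lemma invertible_cell:
  assumes "invertible i"
  shows "i \<in> Cell2 \<BB>" "cod2 \<BB> i = S" "iso2 \<BB> (xi i)" "src \<BB> (dom2 \<BB> i) = A" "trg \<BB> (dom2 \<BB> i) = A"
    "coact i \<in> Cell2 \<BB>" "dom2 \<BB> (coact i) = f" "cod2 \<BB> (coact i) = f \<odot> S"
  using assms by (simp_all add: invertible_def coact_def into_S_cell)

lemma coact_unique:
  assumes "invertible i" "c \<in> Cell2 \<BB>" "dom2 \<BB> c = f" "c \<cdot> xi i = \<iota> f \<star> i"
  shows "c = coact i"
  using assms invertible_cell[OF assms(1)] by (simp add: coact_def vcomp_reassoc flip: assms(4))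

lemma coact_xi:
  assumes "invertible i" shows "coact i \<cdot> xi i = \<iota> f \<star> i"
  using invertible_cell[OF assms] by (simp add: coact_def vcomp_reassoc)

text \<open>
Naturality makes \<open>f\<^sup>* \<otimes> -\<close> faithful on 2-cells out of \<open>y\<close> once the counit at \<open>y\<close> is split epi.  A
section at \<open>y'\<close> provides a right inverse \<open>g\<close> of \<open>\<xi>\<close>, and faithfulness makes it two-sided.

\<close>
lemma counit_reflects_iso:
  assumes [simp]: "\<xi> \<in> Cell2 \<BB>" "dom2 \<BB> \<xi> = y" "cod2 \<BB> \<xi> = y'" "trg \<BB> y = B"
    and iso: "iso2 \<BB> (\<iota> fs \<star> \<xi>)"
    and s [simp]: "s \<in> Cell2 \<BB>" "dom2 \<BB> s = y" "cod2 \<BB> s = f \<odot> fs \<odot> y" "counit y \<cdot> s = \<iota> y"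
    and s' [simp]: "s' \<in> Cell2 \<BB>" "dom2 \<BB> s' = y'" "cod2 \<BB> s' = f \<odot> fs \<odot> y'" "counit y' \<cdot> s' = \<iota> y'"
  shows "iso2 \<BB> \<xi>"
proof -
  have [simp]: "y \<in> Cell1 \<BB>" "y' \<in> Cell1 \<BB>" "trg \<BB> y' = B" using dom_cod_cell[of \<xi>] by simp_all
  define k where "k = inv2 \<BB> (\<iota> fs \<star> \<xi>)"
  have k [simp]: "k \<in> Cell2 \<BB>" "dom2 \<BB> k = fs \<odot> y'" "cod2 \<BB> k = fs \<odot> y" "(\<iota> fs \<star> \<xi>) \<cdot> k = \<iota> (fs \<odot> y')"
    using iso by (simp_all add: k_def)
  define g where "g = counit y \<cdot> (\<iota> f \<star> k) \<cdot> s'"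
  have [simp]: "g \<in> Cell2 \<BB>" "dom2 \<BB> g = y'" "cod2 \<BB> g = y" by (simp_all add: g_def)
  have "\<xi> \<cdot> g = counit y' \<cdot> (\<iota> f \<star> ((\<iota> fs \<star> \<xi>) \<cdot> k)) \<cdot> s'"
    using counit_nat[of \<xi> y', symmetric, THEN prolong]
    by (simp add: g_def whisker_left vcomp_reassoc del: k(4))
  then have right: "\<xi> \<cdot> g = \<iota> y'" by simp
  have "\<iota> fs \<star> (g \<cdot> \<xi>) = \<iota> fs \<star> \<iota> y"
  proof (rule iso2_cancel_left[OF iso])
    show "(\<iota> fs \<star> \<xi>) \<cdot> (\<iota> fs \<star> (g \<cdot> \<xi>)) = (\<iota> fs \<star> \<xi>) \<cdot> (\<iota> fs \<star> \<iota> y)"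
      by (simp add: right[THEN prolong] flip: whisker_left)
  qed simp_all
  then have "(g \<cdot> \<xi>) \<cdot> counit y = counit y"
    using counit_nat[of "g \<cdot> \<xi>" y] by simp
  then have "(g \<cdot> \<xi>) \<cdot> counit y \<cdot> s = counit y \<cdot> s"
    by (rule prolong) simp_all
  then have "g \<cdot> \<xi> = \<iota> y" by simp
  with right have "inverse2 \<BB> \<xi> g" by (intro inverse2I) simp_all
  then show ?thesis by (auto simp: iso2_def)
qed

text \<open>
The map in question is \<open>f\<^sup>* \<otimes> \<xi>\<^sub>i\<close> up to associativity.  The triangle identities provide sections
of the counit at \<open>f \<otimes> J\<close> and at \<open>f\<close>, so that \<open>f\<^sup>* \<otimes> -\<close> reflects invertibility of \<open>\<xi>\<^sub>i\<close>.
\<close>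
lemma invertible_iff:
  assumes [simp]: "i \<in> Cell2 \<BB>" "cod2 \<BB> i = S"
  shows "iso2 \<BB> (m \<cdot> (\<iota> S \<star> i)) \<longleftrightarrow> iso2 \<BB> (xi i)"
proof -
  note [simp] = into_S_cell[OF assms]
  have eq: "m \<cdot> (\<iota> S \<star> i) = (\<iota> fs \<star> xi i) \<cdot> \<a> fs f (dom2 \<BB> i)"
    by (simp add: adj_mult_eq xi_def whisker_left vcomp_reassoc assoc_nat_right)
  show ?thesis
  proof
    assume *: "iso2 \<BB> (m \<cdot> (\<iota> S \<star> i))"
    have "iso2 \<BB> ((m \<cdot> (\<iota> S \<star> i)) \<cdot> inv2 \<BB> (\<a> fs f (dom2 \<BB> i)))"
      by (rule iso2_vcomp(1)[OF _ *]) (simp_all add: adj_mult_eq)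
    then have "iso2 \<BB> (\<iota> fs \<star> xi i)" by (simp add: eq vcomp_reassoc)
    then show "iso2 \<BB> (xi i)"
      by (rule counit_reflects_iso[where y = "f \<odot> dom2 \<BB> i" and y' = f
            and s = "\<iota> f \<star> unit (dom2 \<BB> i)"
            and s' = "(\<iota> f \<star> \<eta>) \<cdot> inv2 \<BB> (\<r> f)", rotated 4])
        (simp_all add: triangle_left zigzag)
  next
    assume "iso2 \<BB> (xi i)"
    then show "iso2 \<BB> (m \<cdot> (\<iota> S \<star> i))" unfolding eq by (intro iso2_vcomp) simp_all
  qed
qed

text \<open>
\<open>\<xi>\<^sub>i\<close> is the transpose of \<open>i\<close>, and this transposes it back.
\<close>
lemma whisker_xi_unit:
  assumes [simp]: "i \<in> Cell2 \<BB>" "cod2 \<BB> i = S"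
  shows "(\<iota> fs \<star> xi i) \<cdot> unit (dom2 \<BB> i) = i"
proof -
  note [simp] = into_S_cell[OF assms]
  have "(\<iota> fs \<star> xi i) \<cdot> unit (dom2 \<BB> i) = (\<iota> fs \<star> counit f) \<cdot> unit S \<cdot> i"
    by (simp add: xi_def whisker_left vcomp_reassoc unit_nat)
  then show ?thesis by (simp add: triangle_right[THEN prolong])
qed

lemma coalgebra_coact:
  assumes "invertible i"
  shows "coalgebra (coact i)" and "unit S \<cdot> i = (\<iota> fs \<star> coact i) \<cdot> i"
proof -
  note [simp] = invertible_cell[OF assms]
  have "counit f \<cdot> coact i = xi i \<cdot> inv2 \<BB> (xi i)"
    unfolding coact_def xi_def[of i, THEN arg_cong[of _ _ "\<lambda>x. x \<cdot> _"]]
    by (rule vcomp_reassoc[symmetric]) simp_all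
  then have 1: "counit f \<cdot> coact i = \<iota> f" by simp
  have "(\<iota> fs \<star> coact i) \<cdot> i = (\<iota> fs \<star> coact i) \<cdot> (\<iota> fs \<star> xi i) \<cdot> unit (dom2 \<BB> i)"
    by (simp add: whisker_xi_unit)
  also have "\<dots> = (\<iota> fs \<star> \<iota> f \<star> i) \<cdot> unit (dom2 \<BB> i)"
    by (simp add: whisker_left[symmetric] whisker_left[symmetric, THEN prolong] coact_xi[OF assms])
  also have "\<dots> = unit S \<cdot> i" by (simp add: unit_nat)
  finally show 2: "unit S \<cdot> i = (\<iota> fs \<star> coact i) \<cdot> i" ..
  have "(\<iota> f \<star> unit S) \<cdot> (\<iota> f \<star> i) = (\<iota> f \<star> \<iota> fs \<star> coact i) \<cdot> (\<iota> f \<star> i)"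
    by (simp add: 2 flip: whisker_left)
  then have "(\<iota> f \<star> unit S) \<cdot> (\<iota> f \<star> i) \<cdot> inv2 \<BB> (xi i)
      = ((\<iota> f \<star> \<iota> fs \<star> coact i) \<cdot> (\<iota> f \<star> i)) \<cdot> inv2 \<BB> (xi i)"
    by (rule prolong) simp_all
  also have "\<dots> = (\<iota> f \<star> \<iota> fs \<star> coact i) \<cdot> (\<iota> f \<star> i) \<cdot> inv2 \<BB> (xi i)"
    by (rule vcomp_reassoc) simp_all
  finally have "(\<iota> f \<star> unit S) \<cdot> coact i = (\<iota> f \<star> \<iota> fs \<star> coact i) \<cdot> coact i"
    by (fold coact_def)
  with 1 show "coalgebra (coact i)" by (simp add: coalgebra_def)
qed

lemma unit_equalizer:
  assumes "right_pure \<BB> A \<eta>" and [simp]: "h \<in> Cell1 \<BB>" "src \<BB> h = A" "trg \<BB> h = A"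
  obtains u v where "is_equalizer \<BB> (unit h) u v"
proof -
  have "regular_mono \<BB> (\<eta> \<star> \<iota> h)" using assms(1) by (simp add: right_pure_def in_hom1_def)
  then obtain u v where "is_equalizer \<BB> (\<eta> \<star> \<iota> h) u v" by (auto simp: regular_mono_def)
  from equalizer_transport[OF this, of "\<a> fs f h" "inv2 \<BB> (\<l> h)"] show ?thesis
    by (intro that) (simp add: unit_def)
qed

text \<open>
A unit that is an equalizer of some pair \<open>u\<close>, \<open>v\<close> is the equalizer of the canonical pair: a 2-cell \<open>t\<close>
equalizing the latter also equalizes \<open>u\<close> and \<open>v\<close>, since this may be checked after composing with
the unit at the target of \<open>u\<close> and \<open>v\<close>, which is monic, and then naturality applies.
\<close>
lemma unit_canonical_equalizer:
  assumes pure: "right_pure \<BB> A \<eta>" and [simp]: "h \<in> Cell1 \<BB>" "src \<BB> h = A" "trg \<BB> h = A"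
    and [simp]: "t \<in> Cell2 \<BB>" "cod2 \<BB> t = fs \<odot> f \<odot> h"
    and t: "unit (fs \<odot> f \<odot> h) \<cdot> t = (\<iota> fs \<star> \<iota> f \<star> unit h) \<cdot> t"
  obtains s where "s \<in> Cell2 \<BB>" "dom2 \<BB> s = dom2 \<BB> t" "cod2 \<BB> s = h" "unit h \<cdot> s = t"
proof -
  obtain u v where e: "is_equalizer \<BB> (unit h) u v" by (rule unit_equalizer[OF pure, of h]) simp_all
  define z where "z = cod2 \<BB> u"
  from equalizer_cell[OF e] have [simp]: "u \<in> Cell2 \<BB>" "v \<in> Cell2 \<BB>" "dom2 \<BB> u = fs \<odot> f \<odot> h" "dom2 \<BB> v = fs \<odot> f \<odot> h"
    "cod2 \<BB> u = z" "cod2 \<BB> v = z"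
    by (simp_all add: z_def)
  have [simp]: "z \<in> Cell1 \<BB>" "src \<BB> z = A" "trg \<BB> z = A"
    using dom_cod_cell(2-4)[of u] by simp_all
  (* monic, so equations between 2-cells into \<open>z\<close> may be checked after composing with it *)
  obtain p q where p: "is_equalizer \<BB> (unit z) p q" by (rule unit_equalizer[OF pure, of z]) simp_all
  have key: "unit z \<cdot> w \<cdot> t = (\<iota> fs \<star> \<iota> f \<star> (w \<cdot> unit h)) \<cdot> t"
    if [simp]: "w \<in> Cell2 \<BB>" "dom2 \<BB> w = fs \<odot> f \<odot> h" "cod2 \<BB> w = z" for w
    by (simp add: unit_nat[THEN prolong] vcomp_reassoc t whisker_left)
  have "u \<cdot> t = v \<cdot> t"
    by (rule equalizer_cancel[OF p]) (simp_all add: key equalizer_cell(7)[OF e])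
  from equalizer_factor[OF e _ _ this] show ?thesis using that by auto
qed

text \<open>
By \<open>whisker_xi_unit\<close>, \<open>i\<close> is the unit at \<open>J\<close>, monic by purity, followed by an isomorphism.
\<close>
lemma mono_invertible:
  assumes "right_pure \<BB> A \<eta>" "invertible i"
  shows "mono2 \<BB> i"
proof (rule mono2I)
  note [simp] = invertible_cell[OF assms(2)]
  show "i \<in> Cell2 \<BB>" by simp
  fix u v assume [simp]: "u \<in> Cell2 \<BB>" "v \<in> Cell2 \<BB>" "dom2 \<BB> u = dom2 \<BB> v"
    "cod2 \<BB> u = dom2 \<BB> i" "cod2 \<BB> v = dom2 \<BB> i" and e: "i \<cdot> u = i \<cdot> v"
  obtain p q where p: "is_equalizer \<BB> (unit (dom2 \<BB> i)) p q"
    by (rule unit_equalizer[OF assms(1), of "dom2 \<BB> i"]) simp_all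
  have *: "(\<iota> fs \<star> xi i) \<cdot> unit (dom2 \<BB> i) \<cdot> w = i \<cdot> w" if "w \<in> Cell2 \<BB>" "cod2 \<BB> w = dom2 \<BB> i" for w
    using that by (simp add: whisker_xi_unit[THEN prolong])
  have "unit (dom2 \<BB> i) \<cdot> u = unit (dom2 \<BB> i) \<cdot> v"
    by (rule iso2_cancel_left[of "\<iota> fs \<star> xi i"]) (simp_all add: * e)
  then show "u = v" by (rule equalizer_cancel[OF p, rotated -1]) simp_all
qed

text \<open>
The universal property of \<open>i\<close> as equalizer of \<open>unit S\<close> and \<open>f\<^sup>* \<otimes> c\<close>; that \<open>i\<close> equalizes them is part
of \<open>coalgebra_coact\<close>.  Transport along \<open>f\<^sup>* \<otimes> \<xi>\<^sub>i\<close> reduces it to the canonical equalizer at \<open>J\<close>.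
\<close>
lemma invertible_factor:
  assumes pure: "right_pure \<BB> A \<eta>" and inv: "invertible i"
    and [simp]: "t \<in> Cell2 \<BB>" "cod2 \<BB> t = S" and t: "unit S \<cdot> t = (\<iota> fs \<star> coact i) \<cdot> t"
  obtains s where "s \<in> Cell2 \<BB>" "dom2 \<BB> s = dom2 \<BB> t" "cod2 \<BB> s = dom2 \<BB> i" "i \<cdot> s = t"
proof -
  note [simp] = invertible_cell[OF inv]
  let ?J = "dom2 \<BB> i"
  let ?x = "\<iota> fs \<star> xi i"
  (* as \<open>i = ?x \<cdot> unit ?J\<close>, factoring \<open>t\<close> through \<open>i\<close> is factoring \<open>r\<close> through the unit *)
  define r where "r = inv2 \<BB> ?x \<cdot> t"
  have r [simp]: "r \<in> Cell2 \<BB>" "dom2 \<BB> r = dom2 \<BB> t" "cod2 \<BB> r = fs \<odot> f \<odot> ?J" by (simp_all add: r_def)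
  have xr: "?x \<cdot> r = t" by (simp add: r_def)
  have "unit (fs \<odot> f \<odot> ?J) \<cdot> r = (\<iota> fs \<star> \<iota> f \<star> unit ?J) \<cdot> r"
  proof (rule iso2_cancel_left[of "\<iota> fs \<star> \<iota> f \<star> ?x"])
    have "(\<iota> fs \<star> \<iota> f \<star> ?x) \<cdot> unit (fs \<odot> f \<odot> ?J) \<cdot> r = unit S \<cdot> ?x \<cdot> r"
      by (simp add: unit_nat[THEN prolong] vcomp_reassoc)
    also have "\<dots> = (\<iota> fs \<star> coact i) \<cdot> ?x \<cdot> r" by (simp add: xr t)
    also have "\<dots> = (\<iota> fs \<star> \<iota> f \<star> i) \<cdot> r"
      by (simp add: whisker_left[symmetric] whisker_left[symmetric, THEN prolong] coact_xi[OF inv])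
    also have "(\<iota> fs \<star> \<iota> f \<star> i) = (\<iota> fs \<star> \<iota> f \<star> ?x) \<cdot> (\<iota> fs \<star> \<iota> f \<star> unit ?J)"
      by (simp add: whisker_left[symmetric] whisker_xi_unit)
    also have "\<dots> \<cdot> r = (\<iota> fs \<star> \<iota> f \<star> ?x) \<cdot> (\<iota> fs \<star> \<iota> f \<star> unit ?J) \<cdot> r"
      by (simp add: vcomp_reassoc)
    finally show "(\<iota> fs \<star> \<iota> f \<star> ?x) \<cdot> unit (fs \<odot> f \<odot> ?J) \<cdot> r = (\<iota> fs \<star> \<iota> f \<star> ?x) \<cdot> (\<iota> fs \<star> \<iota> f \<star> unit ?J) \<cdot> r" .
  qed simp_all
  from unit_canonical_equalizer[OF pure _ _ _ _ _ this]
  obtain s where [simp]: "s \<in> Cell2 \<BB>" "dom2 \<BB> s = dom2 \<BB> r" "cod2 \<BB> s = ?J" and s: "unit ?J \<cdot> s = r"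
    by auto
  have "i \<cdot> s = ?x \<cdot> unit ?J \<cdot> s" by (simp add: whisker_xi_unit[THEN prolong])
  then have "i \<cdot> s = t" by (simp add: s xr)
  then show ?thesis by (intro that[of s]) simp_all
qed

lemma xi_precomp:
  assumes [simp]: "j \<in> Cell2 \<BB>" "cod2 \<BB> j = S" "k \<in> Cell2 \<BB>" "cod2 \<BB> k = dom2 \<BB> j"
  shows "xi (j \<cdot> k) = xi j \<cdot> (\<iota> f \<star> k)"
proof -
  have "trg \<BB> (dom2 \<BB> k) = A" using dom_cod_cell(4)[of k] by (simp add: into_S_cell)
  then show ?thesis by (simp add: xi_def whisker_left vcomp_reassoc into_S_cell)
qed

lemma invertible_precomp_iso:
  assumes inv: "invertible j" and k: "iso2 \<BB> k" and [simp]: "cod2 \<BB> k = dom2 \<BB> j"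
  shows "invertible (j \<cdot> k)" "coact (j \<cdot> k) = coact j"
proof -
  note [simp] = invertible_cell[OF inv] k iso2_cell[OF k]
  have [simp]: "trg \<BB> (dom2 \<BB> k) = A" using dom_cod_cell(4)[of k] by simp
  have x: "xi (j \<cdot> k) = xi j \<cdot> (\<iota> f \<star> k)" by (simp add: xi_precomp)
  have "iso2 \<BB> (xi j \<cdot> (\<iota> f \<star> k))" by (rule iso2_vcomp) simp_all
  then show *: "invertible (j \<cdot> k)" by (simp add: invertible_def x)
  have "coact j \<cdot> xi (j \<cdot> k) = \<iota> f \<star> (j \<cdot> k)"
    by (simp add: x coact_xi[OF inv, THEN prolong] whisker_left)
  then show "coact (j \<cdot> k) = coact j"
    by (intro coact_unique[OF *, symmetric]) simp_all
qed

text \<open>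
Both monomorphisms are equalizers of the same pair, so each factors through the other.
\<close>
lemma coact_determines:
  assumes pure: "right_pure \<BB> A \<eta>" and i: "invertible i" and j: "invertible j" and e: "coact i = coact j"
  obtains k where "iso2 \<BB> k" "dom2 \<BB> k = dom2 \<BB> i" "cod2 \<BB> k = dom2 \<BB> j" "j \<cdot> k = i"
proof -
  note [simp] = invertible_cell[OF i] invertible_cell[OF j]
  obtain k where k [simp]: "k \<in> Cell2 \<BB>" "dom2 \<BB> k = dom2 \<BB> i" "cod2 \<BB> k = dom2 \<BB> j" "j \<cdot> k = i"
    by (rule invertible_factor[OF pure j, of i]) (simp_all add: coalgebra_coact(2)[OF i] flip: e)
  obtain l where l [simp]: "l \<in> Cell2 \<BB>" "dom2 \<BB> l = dom2 \<BB> j" "cod2 \<BB> l = dom2 \<BB> i" "i \<cdot> l = j"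
    by (rule invertible_factor[OF pure i, of j]) (simp_all add: coalgebra_coact(2)[OF j] e)
  have "l \<cdot> k = \<iota> (dom2 \<BB> i)"
    by (rule mono2D[OF mono_invertible[OF pure i]]) (simp_all add: l(4)[THEN prolong])
  moreover have "k \<cdot> l = \<iota> (dom2 \<BB> j)"
    by (rule mono2D[OF mono_invertible[OF pure j]]) (simp_all add: k(4)[THEN prolong])
  ultimately have "inverse2 \<BB> k l" by (intro inverse2I) simp_all
  then show ?thesis by (intro that[of k]) (auto simp: iso2_def)
qed

text \<open>
Let \<open>i\<close> be the equalizer of \<open>unit S\<close> and \<open>f\<^sup>* \<otimes> c\<close>.  By flatness \<open>f \<otimes> i\<close> is an equalizer too, of the
pair of which \<open>c\<close> is a split equalizer; the resulting comparison \<open>k\<close> is inverse to \<open>\<xi>\<^sub>i\<close>.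
\<close>
lemma coact_surj:
  assumes eqs: "hom_has_equalizers \<BB> A A" and fl: "right_flat \<BB> A f" and c: "coalgebra c"
  obtains i where "invertible i" "coact i = c"
proof -
  from c have [simp]: "c \<in> Cell2 \<BB>" "dom2 \<BB> c = f" "cod2 \<BB> c = f \<odot> S"
    and counital: "counit f \<cdot> c = \<iota> f" and coassoc: "(\<iota> f \<star> unit S) \<cdot> c = (\<iota> f \<star> \<iota> fs \<star> c) \<cdot> c"
    by (simp_all add: coalgebra_def)
  obtain i where i: "is_equalizer \<BB> i (unit S) (\<iota> fs \<star> c)"
    using eqs[unfolded hom_has_equalizers_def, rule_format, of S "unit S" "fs \<odot> f \<odot> S" "\<iota> fs \<star> c"]
    by (auto simp: in_hom1_def in_hom2_def)
  have i_cell [simp]: "i \<in> Cell2 \<BB>" "cod2 \<BB> i = S" using equalizer_cell(1,4)[OF i] by simp_all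
  note [simp] = into_S_cell[OF i_cell]
  have Fi: "is_equalizer \<BB> (\<iota> f \<star> i) (\<iota> f \<star> unit S) (\<iota> f \<star> \<iota> fs \<star> c)"
    using fl i by (simp add: right_flat_def in_hom1_def)
  obtain k where [simp]: "k \<in> Cell2 \<BB>" "dom2 \<BB> k = f" "cod2 \<BB> k = f \<odot> dom2 \<BB> i" and k: "(\<iota> f \<star> i) \<cdot> k = c"
    by (rule equalizer_factor[OF Fi, of c]) (simp_all add: coassoc)
  have xk: "xi i \<cdot> k = \<iota> f" by (simp add: xi_def vcomp_reassoc k counital)
  have "k \<cdot> xi i = \<iota> (f \<odot> dom2 \<BB> i)"
  proof (rule equalizer_cancel[OF Fi])
    have "(\<iota> f \<star> i) \<cdot> k \<cdot> xi i = c \<cdot> counit f \<cdot> (\<iota> f \<star> i)"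
      by (simp add: k[THEN prolong]) (simp add: xi_def)
    also have "\<dots> = counit (f \<odot> S) \<cdot> (\<iota> f \<star> \<iota> fs \<star> c) \<cdot> (\<iota> f \<star> i)"
      using counit_nat[of c "f \<odot> S", THEN prolong, of "\<iota> f \<star> i"] by (simp add: vcomp_reassoc)
    also have "\<dots> = counit (f \<odot> S) \<cdot> (\<iota> f \<star> unit S) \<cdot> (\<iota> f \<star> i)"
      by (simp add: equalizer_cell(7)[OF Fi])
    also have "\<dots> = (\<iota> f \<star> i) \<cdot> \<iota> (f \<odot> dom2 \<BB> i)" by (simp add: triangle_left[THEN prolong])
    finally show "(\<iota> f \<star> i) \<cdot> k \<cdot> xi i = (\<iota> f \<star> i) \<cdot> \<iota> (f \<odot> dom2 \<BB> i)" .
  qed simp_all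
  with xk have "inverse2 \<BB> (xi i) k" by (intro inverse2I) simp_all
  then have inv: "invertible i" and "inv2 \<BB> (xi i) = k"
    by (auto simp: invertible_def iso2_def intro: inv2_eq)
  then have "coact i = c" by (simp add: coact_def k)
  with inv show ?thesis by (rule that)
qed

section \<open>Products of subobjects and the comparison isomorphism\<close>

text \<open>
The mate of \<open>\<phi> \<cdot> \<psi>\<close> is tested against \<open>\<xi>\<close> of the product, which is known from \<open>xi_mult\<close>:
cancelling \<open>\<xi>\<^sub>j\<close> turns the mate of \<open>\<psi>\<close> into \<open>j\<close>, and \<open>mate_mult\<close> allows \<open>\<xi>\<^sub>i\<close> to be cancelled
in the same way against the mate of \<open>\<phi>\<close>.
\<close>
lemma invertible_mult:
  assumes i: "invertible i" and j: "invertible j"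
  shows "invertible (m \<cdot> (i \<star> j))" "coact (m \<cdot> (i \<star> j)) = mate (unmate (coact i) \<cdot> unmate (coact j))"
proof -
  note [simp] = invertible_cell[OF i] invertible_cell[OF j]
  let ?I = "dom2 \<BB> i" and ?J = "dom2 \<BB> j"
  have [simp]: "m \<in> Cell2 \<BB>" "dom2 \<BB> m = S \<odot> S" "cod2 \<BB> m = S" by (simp_all add: adj_mult_eq)
  have x: "xi (m \<cdot> (i \<star> j)) = xi j \<cdot> (xi i \<star> \<iota> ?J) \<cdot> inv2 \<BB> (\<a> f ?I ?J)"
    unfolding xi_def by (rule xi_mult) simp_all
  have "iso2 \<BB> (xi j \<cdot> (xi i \<star> \<iota> ?J) \<cdot> inv2 \<BB> (\<a> f ?I ?J))" by (intro iso2_vcomp) simp_all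
  then show *: "invertible (m \<cdot> (i \<star> j))" by (simp add: invertible_def x)
  define \<phi> where "\<phi> = unmate (coact i)"
  define \<psi> where "\<psi> = unmate (coact j)"
  have [simp]: "\<phi> \<in> Cell2 \<BB>" "dom2 \<BB> \<phi> = f \<odot> fs" "cod2 \<BB> \<phi> = f \<odot> fs"
    "\<psi> \<in> Cell2 \<BB>" "dom2 \<BB> \<psi> = f \<odot> fs" "cod2 \<BB> \<psi> = f \<odot> fs" by (simp_all add: \<phi>_def \<psi>_def)
  have f\<phi>: "mate \<phi> = coact i" and f\<psi>: "mate \<psi> = coact j" by (simp_all add: \<phi>_def \<psi>_def mate_unmate)
  let ?d = "\<a> f fs f \<cdot> (\<phi> \<star> \<iota> f) \<cdot> inv2 \<BB> (\<a> f fs f)"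
  have "mate (\<phi> \<cdot> \<psi>) = ?d \<cdot> mate \<psi>" by (simp add: mate_def whisker_right vcomp_reassoc)
  then have "mate (\<phi> \<cdot> \<psi>) \<cdot> xi (m \<cdot> (i \<star> j))
      = ?d \<cdot> coact j \<cdot> xi j \<cdot> (xi i \<star> \<iota> ?J) \<cdot> inv2 \<BB> (\<a> f ?I ?J)"
    by (simp add: f\<psi> x vcomp_reassoc)
  also have "coact j \<cdot> xi j \<cdot> (xi i \<star> \<iota> ?J) \<cdot> inv2 \<BB> (\<a> f ?I ?J) = (\<iota> f \<star> j) \<cdot> (xi i \<star> \<iota> ?J) \<cdot> inv2 \<BB> (\<a> f ?I ?J)"
    by (simp add: coact_xi[OF j, THEN prolong])
  also have "\<dots> = (xi i \<star> \<iota> S) \<cdot> (\<iota> (f \<odot> ?I) \<star> j) \<cdot> inv2 \<BB> (\<a> f ?I ?J)"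
    by (simp add: whisker_exchange[THEN prolong] vcomp_reassoc)
  also have "?d \<cdot> \<dots> = (\<iota> f \<star> m) \<cdot> \<a> f S S \<cdot> (coact i \<star> \<iota> S) \<cdot> (xi i \<star> \<iota> S) \<cdot> (\<iota> (f \<odot> ?I) \<star> j) \<cdot> inv2 \<BB> (\<a> f ?I ?J)"
    by (simp add: mate_mult[of \<phi>, symmetric] f\<phi> vcomp_reassoc)
  also have "\<dots> = (\<iota> f \<star> m) \<cdot> \<a> f S S \<cdot> ((\<iota> f \<star> i) \<star> j) \<cdot> inv2 \<BB> (\<a> f ?I ?J)"
    by (simp add: hcomp_vcomp hcomp_vcomp[THEN prolong] coact_xi[OF i])
  also have "\<dots> = \<iota> f \<star> (m \<cdot> (i \<star> j))"
    by (simp add: assoc_nat[THEN prolong] whisker_left vcomp_reassoc)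
  finally show "coact (m \<cdot> (i \<star> j)) = mate (\<phi> \<cdot> \<psi>)"
    by (intro coact_unique[OF *, symmetric]) simp_all
qed

text \<open>
The triangle identity says that \<open>\<xi>\<^sub>\<eta>\<close> is the unit constraint.
\<close>
lemma invertible_one: "invertible \<eta>" "coact \<eta> = mate (\<iota> (f \<odot> fs))"
proof -
  have "xi \<eta> = (counit f \<cdot> (\<iota> f \<star> \<eta>) \<cdot> inv2 \<BB> (\<r> f)) \<cdot> \<r> f" by (simp add: xi_def vcomp_reassoc)
  then have x: "xi \<eta> = \<r> f" by (simp add: zigzag)
  then show *: "invertible \<eta>" by (simp add: invertible_def)
  show "coact \<eta> = mate (\<iota> (f \<odot> fs))"
    by (rule coact_unique[OF *, symmetric]) (simp_all add: x mate_def unit'_def vcomp_reassoc)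
qed

definition fibre :: "'c \<Rightarrow> 'c set" where
  "fibre c = {i. invertible i \<and> coact i = c}"

lemma subobject_eq_fibre:
  assumes pure: "right_pure \<BB> A \<eta>" and i: "invertible i"
  shows "subobject \<BB> S i = fibre (coact i)"
proof (intro equalityI subsetI)
  fix j assume "j \<in> subobject \<BB> S i"
  then obtain k where j: "mono2 \<BB> j" and k: "iso2 \<BB> k" "dom2 \<BB> k = dom2 \<BB> i" "cod2 \<BB> k = dom2 \<BB> j" "j \<cdot> k = i"
    unfolding subobject_def sub_equiv_def in_hom2_def by blast
  from j have "(j \<cdot> k) \<cdot> inv2 \<BB> k = j"
    using k(1-3) iso2_cell[OF k(1)] by (simp add: vcomp_reassoc mono2_def)
  then have "j = i \<cdot> inv2 \<BB> k" by (simp only: k(4))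
  moreover have "invertible (i \<cdot> inv2 \<BB> k)" "coact (i \<cdot> inv2 \<BB> k) = coact i"
    using invertible_precomp_iso[OF i, of "inv2 \<BB> k"] k(1,2) by simp_all
  ultimately show "j \<in> fibre (coact i)" by (simp only: fibre_def mem_Collect_eq)
next
  fix j assume "j \<in> fibre (coact i)"
  then have j: "invertible j" and e: "coact i = coact j" by (auto simp: fibre_def)
  obtain k where "iso2 \<BB> k" "dom2 \<BB> k = dom2 \<BB> i" "cod2 \<BB> k = dom2 \<BB> j" "j \<cdot> k = i"
    by (rule coact_determines[OF pure i j e])
  moreover from this have "k \<in> Cell2 \<BB>" by (intro iso2_cell)
  ultimately show "j \<in> subobject \<BB> S i"
    using mono_invertible[OF pure i] mono_invertible[OF pure j] invertible_cell(2)[OF i] invertible_cell(2)[OF j]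
    unfolding subobject_def sub_equiv_def in_hom2_def by blast
qed

end

text \<open>
If the structure of \<open>M\<close> is the image under \<open>K\<close> of that of a monoid \<open>N\<close>, and \<open>\<Gamma>\<close> is a left inverse
of \<open>K\<close>, then \<open>M\<close> satisfies the monoid axioms as well.
\<close>
lemma monoid_isoI:
  assumes N: "monoid N" and M: "carrier M = K ` carrier N" "\<one>\<^bsub>M\<^esub> = K \<one>\<^bsub>N\<^esub>"
    "\<And>x y. x \<in> carrier N \<Longrightarrow> y \<in> carrier N \<Longrightarrow> K x \<otimes>\<^bsub>M\<^esub> K y = K (x \<otimes>\<^bsub>N\<^esub> y)"
    and G: "\<And>x. x \<in> carrier N \<Longrightarrow> \<Gamma> (K x) = x"
  shows "monoid_iso M N \<Gamma>"
proof -
  interpret N: monoid N by (rule N)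
  have "monoid M"
    by (rule monoidI) (auto simp: M N.m_assoc)
  moreover have "\<Gamma> \<in> iso M N"
    by (force simp: iso_def hom_def bij_betw_def inj_on_def M G)
  ultimately show ?thesis by (simp add: monoid_iso_def N M G)
qed

context bicategory_adjunction
begin

lemma I_left_carrier:
  assumes pure: "right_pure \<BB> A \<eta>" and eqs: "hom_has_equalizers \<BB> A A" and fl: "right_flat \<BB> A f"
  shows "carrier (I_left \<BB> S \<eta> m) = (\<lambda>\<phi>. fibre (mate \<phi>)) ` carrier endo"
proof (intro equalityI subsetI)
  fix P assume "P \<in> carrier (I_left \<BB> S \<eta> m)"
  then obtain i where P: "P = subobject \<BB> S i" and i: "mono2 \<BB> i" "cod2 \<BB> i = S" "iso2 \<BB> (m \<cdot> (\<iota> S \<star> i))"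
    by (auto simp: I_left_def)
  then have inv: "invertible i" by (simp add: invertible_def mono2_def invertible_iff)
  note [simp] = invertible_cell[OF inv]
  have "P = fibre (mate (unmate (coact i)))" by (simp add: P subobject_eq_fibre[OF pure inv] mate_unmate)
  moreover have "unmate (coact i) \<in> carrier endo"
    using coalgebra_coact(1)[OF inv] by (simp add: endo_carrier mate_unmate)
  ultimately show "P \<in> (\<lambda>\<phi>. fibre (mate \<phi>)) ` carrier endo" by blast
next
  fix P assume "P \<in> (\<lambda>\<phi>. fibre (mate \<phi>)) ` carrier endo"
  then obtain \<phi> where P: "P = fibre (mate \<phi>)" and "coalgebra (mate \<phi>)" by (auto simp: endo_carrier)
  then obtain i where i: "invertible i" "coact i = mate \<phi>" by (metis coact_surj[OF eqs fl])
  then have "P = subobject \<BB> S i" by (simp add: P subobject_eq_fibre[OF pure])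
  then show "P \<in> carrier (I_left \<BB> S \<eta> m)"
    using mono_invertible[OF pure i(1)] invertible_cell[OF i(1)] by (auto simp: I_left_def invertible_iff)
qed

lemma Gamma_left_fibre:
  assumes "fibre c \<noteq> {}"
  shows "Gamma_left \<BB> f fs \<epsilon> (fibre c) = unmate c"
proof -
  let ?g = "\<lambda>i. \<r> (f \<odot> fs) \<cdot> (\<iota> (f \<odot> fs) \<star> \<epsilon>) \<cdot> rebracket \<BB> f fs \<cdot>
             ((\<iota> f \<star> i) \<star> \<iota> fs) \<cdot> (inv2 \<BB> (xi_left \<BB> f fs \<epsilon> i) \<star> \<iota> fs)"
  (* the formula takes the same value on every representative *)
  have "?g i = unmate c" if "i \<in> fibre c" for i
  proof -
    from that have i: "invertible i" and c: "c = coact i" by (auto simp: fibre_def)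
    note [simp] = invertible_cell[OF i]
    have "xi_left \<BB> f fs \<epsilon> i = xi i" by (simp add: xi_left_eq xi_def)
    then show ?thesis by (simp add: unmate_def c coact_def whisker_right)
  qed
  with assms have "?g ` fibre c = {unmate c}" by auto
  then show ?thesis by (simp add: Gamma_left_def)
qed

lemma monoid_iso_left:
  assumes pure: "right_pure \<BB> A \<eta>" and eqs: "hom_has_equalizers \<BB> A A" and fl: "right_flat \<BB> A f"
  shows "monoid_iso (I_left \<BB> S \<eta> m) endo (Gamma_left \<BB> f fs \<epsilon>)"
proof (rule monoid_isoI[OF monoid_endo I_left_carrier[OF assms]])
  have nonempty: "fibre (mate \<phi>) \<noteq> {}" if "\<phi> \<in> carrier endo" for \<phi>
    using that coact_surj[OF eqs fl, of "mate \<phi>"] by (auto simp: fibre_def endo_carrier)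
  have "\<one>\<^bsub>endo\<^esub> = \<iota> (f \<odot> fs)" by (simp add: comonoid_End_def)
  then show "\<one>\<^bsub>I_left \<BB> S \<eta> m\<^esub> = fibre (mate \<one>\<^bsub>endo\<^esub>)"
    using subobject_eq_fibre[OF pure invertible_one(1)] by (simp add: I_left_def invertible_one)
  show "Gamma_left \<BB> f fs \<epsilon> (fibre (mate \<phi>)) = \<phi>" if "\<phi> \<in> carrier endo" for \<phi>
    using that by (simp add: Gamma_left_fibre[OF nonempty[OF that]] endo_carrier unmate_mate)
  show "fibre (mate \<phi>) \<otimes>\<^bsub>I_left \<BB> S \<eta> m\<^esub> fibre (mate \<psi>) = fibre (mate (\<phi> \<otimes>\<^bsub>endo\<^esub> \<psi>))"
    if \<phi>: "\<phi> \<in> carrier endo" and \<psi>: "\<psi> \<in> carrier endo" for \<phi> \<psi>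
  proof -
    have "subobject \<BB> S (m \<cdot> (i \<star> j)) = fibre (mate (\<phi> \<cdot> \<psi>))"
      if "i \<in> fibre (mate \<phi>)" "j \<in> fibre (mate \<psi>)" for i j
    proof -
      from that have i: "invertible i" "coact i = mate \<phi>" and j: "invertible j" "coact j = mate \<psi>"
        by (auto simp: fibre_def)
      show ?thesis
        using \<phi> \<psi> by (simp add: subobject_eq_fibre[OF pure] invertible_mult[OF i(1) j(1)]
            i(2) j(2) unmate_mate endo_carrier)
    qed
    then have "{subobject \<BB> S (m \<cdot> (i \<star> j)) | i j. i \<in> fibre (mate \<phi>) \<and> j \<in> fibre (mate \<psi>)} = {fibre (mate (\<phi> \<cdot> \<psi>))}"
      using nonempty[OF \<phi>] nonempty[OF \<psi>] by blast
    then show ?thesis by (simp add: I_left_def sub_mult_def comonoid_End_def)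
  qed
qed

end

section \<open>Reversal and the right-handed case\<close>

lemma op_I_left: "I_left (op_bicat \<BB>) S e m = opposite_monoid (I_right \<BB> S e m)"
proof -
  have "sub_mult (op_bicat \<BB>) S m = (\<lambda>P Q. sub_mult \<BB> S m Q P)"
    unfolding sub_mult_def by (intro ext arg_cong[where f = the_elem]) auto
  then show ?thesis by (simp add: I_left_def I_right_def opposite_monoid_def)
qed

lemma op_comonoid_End: "comonoid_End (op_bicat \<BB>) C \<delta> \<epsilon> = comonoid_End \<BB> C \<delta> \<epsilon>"
  by (simp add: comonoid_End_def)

lemma op_hypotheses:
  "hom_has_equalizers (op_bicat \<BB>) X Y = hom_has_equalizers \<BB> Y X"
  "right_flat (op_bicat \<BB>) X g = left_flat \<BB> X g"
  "right_pure (op_bicat \<BB>) X \<tau> = left_pure \<BB> X \<tau>"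
  by (auto simp: hom_has_equalizers_def right_flat_def left_flat_def right_pure_def left_pure_def)

lemma monoid_iso_cong:
  assumes "monoid_iso M N \<phi>" "\<And>x. x \<in> carrier M \<Longrightarrow> \<phi> x = \<psi> x"
  shows "monoid_iso M N \<psi>"
proof -
  interpret monoid M using assms(1) by (simp add: monoid_iso_def)
  have "\<psi> \<in> iso M N"
    using assms bij_betw_cong[of "carrier M" \<phi> \<psi> "carrier N"]
    by (auto simp: monoid_iso_def iso_def hom_def dest: bij_betwE)
  then show ?thesis using assms(1) assms(2)[OF one_closed] by (simp add: monoid_iso_def)
qed

context bicategory_adjunction
begin

text \<open>
The formulas for \<open>\<Gamma>\<close> contain an inverse, so rebracketing them requires that \<open>\<xi>\<close> is invertible for
every representative of a class.
\<close>
lemma I_left_member: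
  assumes "right_pure \<BB> A \<eta>" "P \<in> carrier (I_left \<BB> S \<eta> m)" "i \<in> P"
  shows "i \<in> Cell2 \<BB>" "cod2 \<BB> i = S" "iso2 \<BB> (xi_left \<BB> f fs \<epsilon> i)"
proof -
  from assms(2) obtain j where P: "P = subobject \<BB> S j" and "invertible j"
    by (auto simp: I_left_def invertible_def mono2_def invertible_iff)
  then have "P = fibre (coact j)" by (simp add: subobject_eq_fibre[OF assms(1)])
  with assms(3) have "invertible i" by (simp add: fibre_def)
  note this [THEN invertible_cell(1)] this[THEN invertible_cell(2)] this[THEN invertible_cell(3)]
  then show "i \<in> Cell2 \<BB>" "cod2 \<BB> i = S" "iso2 \<BB> (xi_left \<BB> f fs \<epsilon> i)"
    by (simp_all add: xi_left_eq xi_def)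
qed

text \<open>
The two formulas differ only in the bracketing of vertical composites.
\<close>
lemma op_Gamma_left:
  assumes "left_pure \<BB> A \<eta>" "P \<in> carrier (I_left (op_bicat \<BB>) S \<eta> m)"
  shows "Gamma_left (op_bicat \<BB>) fs f \<epsilon> P = Gamma_right \<BB> f fs \<epsilon> P"
proof -
  have xi: "xi_left (op_bicat \<BB>) fs f \<epsilon> i = xi_right \<BB> f fs \<epsilon> i" for i
    by (simp add: xi_left_def xi_right_def)
  show ?thesis
    unfolding Gamma_left_def Gamma_right_def
  proof (intro arg_cong[where f = the_elem] image_cong refl)
    fix i assume "i \<in> P"
    then have [simp]: "i \<in> Cell2 \<BB>" "cod2 \<BB> i = S" "iso2 \<BB> (xi_right \<BB> f fs \<epsilon> i)"
      using bicategory_adjunction.I_left_member[OF adjunction_op_bicat, of P i] assms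
      by (simp_all add: op_hypotheses op_bicat_adj_mult xi)
    note [simp] = into_S_cell[of i]
    have [simp]: "xi_right \<BB> f fs \<epsilon> i \<in> Cell2 \<BB>" "dom2 \<BB> (xi_right \<BB> f fs \<epsilon> i) = dom2 \<BB> i \<odot> fs"
      "cod2 \<BB> (xi_right \<BB> f fs \<epsilon> i) = fs"
      by (simp_all add: xi_right_def)
    show "\<r>\<^bsub>op_bicat \<BB>\<^esub> (fs \<odot>\<^bsub>op_bicat \<BB>\<^esub> f) \<cdot>\<^bsub>op_bicat \<BB>\<^esub> (\<iota>\<^bsub>op_bicat \<BB>\<^esub> (fs \<odot>\<^bsub>op_bicat \<BB>\<^esub> f) \<star>\<^bsub>op_bicat \<BB>\<^esub> \<epsilon>)
        \<cdot>\<^bsub>op_bicat \<BB>\<^esub>         rebracket (op_bicat \<BB>) fs f \<cdot>\<^bsub>op_bicat \<BB>\<^esub> ((\<iota>\<^bsub>op_bicat \<BB>\<^esub> fs \<star>\<^bsub>op_bicat \<BB>\<^esub> i) \<star>\<^bsub>op_bicat \<BB>\<^esub> \<iota>\<^bsub>op_bicat \<BB>\<^esub> f) \<cdot>\<^bsub>op_bicat \<BB>\<^esub>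
        (inv2 (op_bicat \<BB>) (xi_left (op_bicat \<BB>) fs f \<epsilon> i) \<star>\<^bsub>op_bicat \<BB>\<^esub> \<iota>\<^bsub>op_bicat \<BB>\<^esub> f)
      = \<l> (f \<odot> fs) \<cdot> (\<epsilon> \<star> \<iota> (f \<odot> fs)) \<cdot> inv2 \<BB> (\<a> f fs (f \<odot> fs)) \<cdot> (\<iota> f \<star> \<a> fs f fs) \<cdot>
        (\<iota> f \<star> (i \<star> \<iota> fs)) \<cdot> (\<iota> f \<star> inv2 \<BB> (xi_right \<BB> f fs \<epsilon> i))"
      by (simp add: xi rebracket_def vcomp_reassoc)
  qed
qed

lemma monoid_iso_right:
  assumes "left_pure \<BB> A \<eta>" "hom_has_equalizers \<BB> A A" "left_flat \<BB> A fs"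
  shows "monoid_iso (opposite_monoid (I_right \<BB> S \<eta> m)) endo (Gamma_right \<BB> f fs \<epsilon>)"
proof (rule monoid_iso_cong)
  show "monoid_iso (opposite_monoid (I_right \<BB> S \<eta> m)) endo (Gamma_left (op_bicat \<BB>) fs f \<epsilon>)"
    using bicategory_adjunction.monoid_iso_left[OF adjunction_op_bicat] assms
    by (simp add: op_hypotheses op_I_left op_comonoid_End op_bicat_adj_mult op_bicat_adj_comult)
  show "Gamma_left (op_bicat \<BB>) fs f \<epsilon> P = Gamma_right \<BB> f fs \<epsilon> P"
    if "P \<in> carrier (opposite_monoid (I_right \<BB> S \<eta> m))" for P
    using that op_Gamma_left[OF assms(1), of P] by (simp add: op_I_left)
qed
end

theorem theorem3p4:
  fixes \<BB> :: "('o, 'm, 'c, 'z) bicat_scheme"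
    and A B :: 'o and f fs :: 'm and \<eta> \<epsilon> :: 'c
  assumes "bicategory \<BB>"
    and "adjunction \<BB> A B f fs \<eta> \<epsilon>"
    and "hom_has_equalizers \<BB> A A"
  shows
    "(right_flat \<BB> A f \<and> right_pure \<BB> A \<eta> \<longrightarrow>
        monoid_iso
          (I_left \<BB> (fs \<odot>\<^bsub>\<BB>\<^esub> f) \<eta> (adj_mult \<BB> f fs \<epsilon>))
          (comonoid_End \<BB> (f \<odot>\<^bsub>\<BB>\<^esub> fs) (adj_comult \<BB> f fs \<eta>) \<epsilon>)
          (Gamma_left \<BB> f fs \<epsilon>)) \<and>
     (left_flat \<BB> A fs \<and> left_pure \<BB> A \<eta> \<longrightarrow>
        monoid_iso
          (opposite_monoid (I_right \<BB> (fs \<odot>\<^bsub>\<BB>\<^esub> f) \<eta> (adj_mult \<BB> f fs \<epsilon>)))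
          (comonoid_End \<BB> (f \<odot>\<^bsub>\<BB>\<^esub> fs) (adj_comult \<BB> f fs \<eta>) \<epsilon>)
          (Gamma_right \<BB> f fs \<epsilon>))"
proof -
  interpret bicategory_adjunction \<BB> A B f fs \<eta> \<epsilon>
    using assms(1,2) by (simp add: bicategory_adjunction_def bicategory_adjunction_axioms_def)
  show ?thesis using monoid_iso_left monoid_iso_right assms(3) by blast
qed

end
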